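(* Let $d\ge3$. There exists $\eta>0$ such that for $\mathbb{P}$-a.e. $\omega$ the quenched large deviation principle for $X_n/n$ under $P_{0,0}^\omega$ holds in the $\eta$-neighborhood of $\xi_o$ with rate function $I_c$: for every Borel set $G$ contained in $\{\xi:|\xi-\xi_o|<\eta\}$, $$-\inf_{\xi\in G^o}I_c(\xi)\le\liminf_{n\to\infty}\frac1n\log P_{0,0}^\omega\left(\tfrac{X_n}{n}\in G\right)\le\limsup_{n\to\infty}\frac1n\log P_{0,0}^\omega\left(\tfrac{X_n}{n}\in G\right)\le-\inf_{\xi\in\bar G}I_c(\xi).$$
   Context: Space-time RWRE: environment $\omega=(\omega_{n,x})_{n\in\mathbb{Z},x\in\mathbb{Z}^d}$ with $\omega_{n,x}=(\pi_{n,n+1}(x,x+z))_{z\in U}$ probability vectors, $U:=\{z\in\mathbb{Z}^d:|z_1|+\cdots+|z_d|=1\}$; under $\mathbb{P}$ the $\omega_{n,x}$ are i.i.d., and there is $c_1>0$ with $\mathbb{P}(\pi_{0,1}(0,z)\ge c_1)=1$ for all $z\in U$. $P_{k,x}^\omega$ is the law of the walk $(X_n)_{n\ge k}$ with $X_k=x$ and $P(X_{n+1}=y+z\mid X_n=y)=\pi_{n,n+1}(y,y+z)$. $q(z):=\mathbb{E}[\pi_{0,1}(0,z)]$, $\xi_o:=\sum_{z\in U}q(z)z$, $\Lambda_c(\theta):=\log\sum_{z\in U}q(z)\mathrm{e}^{\langle\theta,z\rangle}$, and $I_c(\xi):=\sup_\theta\{\langle\theta,\xi\rangle-\Lambda_c(\theta)\}$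 (the averaged rate function). *)

theory Defs
  imports "HOL-Probability.Probability"
begin

definition steps :: "(int^'d::finite) set" where
  "steps = {z. (\<Sum>i\<in>UNIV. \<bar>z $ i\<bar>) = 1}"

text \<open>Environments: omega (n,x) is the transition vector at time n, site x;
  omega (n,x) z = pi_{n,n+1}(x,x+z).\<close>
type_synonym 'd env = "int \<times> (int^'d) \<Rightarrow> ((int^'d) \<Rightarrow> real)"

definition path_prob :: "'d::finite env \<Rightarrow> int \<Rightarrow> int^'d \<Rightarrow> (int^'d) list \<Rightarrow> real" where
  "path_prob \<omega> k x s = (\<Prod>j<length s. \<omega> (k + int j, x + sum_list (take j s)) (s ! j))"

definition quenched_prob :: "'d::finite env \<Rightarrow> int \<Rightarrow> int^'d \<Rightarrow> nat \<Rightarrow> (int^'d) set \<Rightarrow> real" where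
  "quenched_prob \<omega> k x n A =
     (\<Sum>s\<in>{s. length s = n \<and> set s \<subseteq> steps}.
        if x + sum_list s \<in> A then path_prob \<omega> k x s else 0)"

definition to_real_vec :: "int^'d::finite \<Rightarrow> real^'d" where
  "to_real_vec y = (\<chi> i. real_of_int (y $ i))"

definition q_avg :: "(int^'d::finite \<Rightarrow> real) measure \<Rightarrow> int^'d \<Rightarrow> real" where
  "q_avg \<mu> z = (\<integral>v. v z \<partial>\<mu>)"

definition xi_o :: "(int^'d::finite \<Rightarrow> real) measure \<Rightarrow> real^'d" where
  "xi_o \<mu> = (\<Sum>z\<in>steps. q_avg \<mu> z *\<^sub>R to_real_vec z)"

definition Lambda_c :: "(int^'d::finite \<Rightarrow> real) measure \<Rightarrow> real^'d \<Rightarrow> real" where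
  "Lambda_c \<mu> \<theta> = ln (\<Sum>z\<in>steps. q_avg \<mu> z * exp (\<theta> \<bullet> to_real_vec z))"

definition I_c :: "(int^'d::finite \<Rightarrow> real) measure \<Rightarrow> real^'d \<Rightarrow> ereal" where
  "I_c \<mu> \<xi> = (SUP \<theta>. ereal (\<theta> \<bullet> \<xi> - Lambda_c \<mu> \<theta>))"

definition eln :: "real \<Rightarrow> ereal" where
  "eln p = (if p = 0 then -\<infinity> else ereal (ln p))"

definition ldp_seq :: "'d::finite env \<Rightarrow> (real^'d) set \<Rightarrow> nat \<Rightarrow> ereal" where
  "ldp_seq \<omega> G n = ereal (1 / real n) *
     eln (quenched_prob \<omega> 0 0 n {y. (1 / real n) *\<^sub>R to_real_vec y \<in> G})"

end

theory Submission
  imports Defs "HOL-Real_Asymp.Real_Asymp"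
begin

text \<open>
  The upper bound needs no smallness: the quenched probability of a site exceeds the averaged one
  by at most a polynomial factor (Markov's inequality and Borel--Cantelli over the polynomially
  many reachable sites), and the averaged one obeys the Chernoff bound.

  For the lower bound at \<open>\<xi> = \<nabla>\<Lambda>\<^sub>c(\<theta>)\<close> with
  \<open>\<theta>\<close> small, let \<open>Z\<close> be the quenched partition function of the
  paths tilted by \<open>\<theta>\<close> and ending near \<open>n\<xi>\<close>. Its mean tends to
  1, and its second moment is bounded: it is the mass of a pair of tilted walks that interact only
  when they meet, and in dimension at least 3 the difference walk has a superharmonic function of
  the form \<open>(b + \<langle>x, Q x\<rangle>) powr (-1/4)\<close>, with \<open>Q\<close> the
  inverse covariance, whose strict decrease at the origin pays for the interaction. Hence
  \<open>Z\<close> is bounded below with positive probability. By ellipticity, resampling one time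
  layer changes \<open>ln Z\<close> by a bounded amount, so McDiarmid's inequality makes \<open>ln
  Z\<close> concentrate on the scale \<open>sqrt n\<close> and \<open>Z\<close> is almost surely
  not exponentially small.
\<close>

section \<open>Lattice steps and paths\<close>

text \<open>The neighbourhood is small because the second moment tolerates only small tilts: a pair
  of walks can gain mass when it meets, and this gain must stay below the drop of the superharmonic
  function next to the origin. As for the power -1/4: in the inverse-covariance metric the squared
  length has mean increment d, and the second moment of its increment is about 4 times the squared
  length, so the power -a is superharmonic far out once \<open>2 * (a + 1) < d\<close>. Some a > 0
  qualifies only for d at least 3, and 1/4 leaves slack for the tilt. The second moment yields only
  positive probability; concentration is then used twice, the upper tail to keep the mean of ln Z
  from being very negative, the lower tail to keep ln Z near that mean with summable failure
  probability. The quantifier over G stands inside the almost sure statement, so no exceptional set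
  may depend on G: the upper bound controls all endpoints by one random variable, the lower bound
  uses countably many tilts, radii and rates.\<close>

lemma norm_to_real_vec_step:
  assumes "z \<in> (steps :: (int^'d::finite) set)" shows "norm (to_real_vec z) \<le> 1"
proof -
  have "norm (to_real_vec z) \<le> (\<Sum>i\<in>UNIV. \<bar>to_real_vec z $ i\<bar>)" by (rule norm_le_l1_cart)
  also have "\<dots> = of_int (\<Sum>i\<in>UNIV. \<bar>z $ i\<bar>)" by (simp add: to_real_vec_def)
  also have "\<dots> = 1" using assms by (simp add: steps_def)
  finally show ?thesis .
qed

lemma axis_in_steps: "axis i 1 \<in> steps" "axis i (-1) \<in> steps"
  by (auto simp: steps_def axis_def if_distrib[of abs] cong: if_cong)

lemma to_real_vec_axis [simp]: "to_real_vec (axis i c) = axis i (of_int c)"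
  by (auto simp: to_real_vec_def axis_def vec_eq_iff)

lemma to_real_vec_add [simp]: "to_real_vec (x + y) = to_real_vec x + to_real_vec y"
  and to_real_vec_diff [simp]: "to_real_vec (x - y) = to_real_vec x - to_real_vec y"
  and to_real_vec_0 [simp]: "to_real_vec 0 = 0"
  by (auto simp: to_real_vec_def vec_eq_iff)

lemma finite_box: "finite {y :: int^'d::finite. \<forall>i. \<bar>y $ i\<bar> \<le> n}"
  and card_box_le: "card {y :: int^'d::finite. \<forall>i. \<bar>y $ i\<bar> \<le> n} \<le> card {-n..n} ^ CARD('d)"
proof -
  let ?B = "{y :: int^'d. \<forall>i. \<bar>y $ i\<bar> \<le> n}" and ?P = "PiE (UNIV :: 'd set) (\<lambda>_. {-n..n})"
  have inj: "inj_on vec_nth ?B" by (auto simp: inj_on_def vec_eq_iff)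
  have sub: "vec_nth ` ?B \<subseteq> ?P" by (auto simp: abs_le_iff) (metis minus_le_iff)
  have fin: "finite ?P" by (intro finite_PiE) auto
  show "finite ?B" using finite_subset[OF sub fin] inj finite_imageD by blast
  have "card ?B \<le> card ?P" using card_inj_on_le[OF inj sub fin] .
  also have "\<dots> = card {-n..n} ^ CARD('d)" by (subst card_PiE) auto
  finally show "card ?B \<le> card {-n..n} ^ CARD('d)" .
qed

lemma step_component_le:
  assumes "z \<in> (steps :: (int^'d::finite) set)" shows "\<bar>z $ i\<bar> \<le> 1"
proof -
  have "\<bar>z $ i\<bar> \<le> (\<Sum>i\<in>UNIV. \<bar>z $ i\<bar>)" by (rule member_le_sum) auto
  then show ?thesis using assms by (simp add: steps_def)
qed

lemma finite_steps [simp]: "finite (steps :: (int^'d::finite) set)"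
  by (rule finite_subset[OF _ finite_box[of 1]]) (auto dest: step_component_le)

lemma steps_nonempty [simp]: "(steps :: (int^'d::finite) set) \<noteq> {}"
  using axis_in_steps by auto

section \<open>Paths and weighted sums over them\<close>

definition paths :: "nat \<Rightarrow> (int^'d::finite) list set" where
  "paths n = {s. length s = n \<and> set s \<subseteq> steps}"

lemma finite_paths [simp]: "finite (paths n :: (int^'d::finite) list set)"
  unfolding paths_def using finite_lists_length_eq[OF finite_steps, of n] by (simp add: conj_commute)

lemma paths_0 [simp]: "paths 0 = {[]}"
  by (auto simp: paths_def)

lemma length_paths: "s \<in> paths n \<Longrightarrow> length s = n"
  by (simp add: paths_def)

lemma nth_paths: "s \<in> paths n \<Longrightarrow> j < n \<Longrightarrow> s ! j \<in> steps"
  by (auto simp: paths_def)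

lemma sum_paths_Suc: "(\<Sum>s\<in>paths (Suc n). f s) = (\<Sum>z\<in>steps. \<Sum>s\<in>paths n. f (z # s))"
proof -
  have "(\<Sum>z\<in>steps. \<Sum>s\<in>paths n. f (z # s)) = (\<Sum>(z,s)\<in>steps \<times> paths n. f (z # s))"
    by (rule sum.cartesian_product)
  also have "\<dots> = (\<Sum>s\<in>paths (Suc n). f s)"
    by (rule sum.reindex_bij_witness[of _ "\<lambda>s. (hd s, tl s)" "\<lambda>(z,s). z # s"])
       (auto simp: paths_def length_Suc_conv)
  finally show ?thesis ..
qed

lemma quenched_prob_eq:
  "quenched_prob \<omega> k x n A = (\<Sum>s\<in>paths n. if x + sum_list s \<in> A then path_prob \<omega> k x s else 0)"
  by (simp add: quenched_prob_def paths_def)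

text \<open>The supermartingale argument for \<open>h\<close> along the difference of two walks:
  averaging over the first pair of steps never increases \<open>h\<close>, and
  \<open>h \<ge> 1\<close> bounds the final value from below. The kernel may have mass above 1 at
  some displacements, which is how a reward for meetings enters.\<close>

lemma pair_weight_le:
  fixes k :: "int^'d::finite \<Rightarrow> int^'d \<Rightarrow> int^'d \<Rightarrow> real" and h :: "int^'d \<Rightarrow> real"
  assumes k: "\<And>x z w. z \<in> steps \<Longrightarrow> w \<in> steps \<Longrightarrow> k x z w \<ge> 0" and h: "\<And>x. h x \<ge> 1"
    and sup: "\<And>x. (\<Sum>z\<in>steps. \<Sum>w\<in>steps. k x z w * h (x + z - w)) \<le> h x"
  shows "(\<Sum>s\<in>paths n. \<Sum>t\<in>paths n.
    \<Prod>j<n. k (x + sum_list (take j s) - sum_list (take j t)) (s ! j) (t ! j)) \<le> h x"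
proof (induction n arbitrary: x)
  case 0
  then show ?case using h by simp
next
  case (Suc n)
  have "(\<Sum>s\<in>paths (Suc n). \<Sum>t\<in>paths (Suc n).
      \<Prod>j<Suc n. k (x + sum_list (take j s) - sum_list (take j t)) (s ! j) (t ! j))
    = (\<Sum>z\<in>steps. \<Sum>s\<in>paths n. \<Sum>w\<in>steps. \<Sum>t\<in>paths n. k x z w *
      (\<Prod>j<n. k ((x + z - w) + sum_list (take j s) - sum_list (take j t)) (s ! j) (t ! j)))"
    unfolding sum_paths_Suc prod.lessThan_Suc_shift by (simp add: algebra_simps)
  also have "\<dots> = (\<Sum>z\<in>steps. \<Sum>w\<in>steps. \<Sum>s\<in>paths n. \<Sum>t\<in>paths n. k x z w *
      (\<Prod>j<n. k ((x + z - w) + sum_list (take j s) - sum_list (take j t)) (s ! j) (t ! j)))"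
    by (intro sum.cong refl sum.swap)
  also have "\<dots> \<le> (\<Sum>z\<in>steps. \<Sum>w\<in>steps. k x z w * h (x + z - w))"
    using Suc.IH k by (auto simp flip: sum_distrib_left intro!: sum_mono mult_left_mono)
  also have "\<dots> \<le> h x" by (rule sup)
  finally show ?case .
qed

lemma sum_paths_prod:
  fixes p :: "int^'d::finite \<Rightarrow> real"
  shows "(\<Sum>s\<in>paths n. \<Prod>j<n. p (s ! j)) = (sum p steps) ^ n"
proof (induction n)
  case (Suc n)
  have "(\<Sum>s\<in>paths (Suc n). \<Prod>j<Suc n. p (s ! j)) = (\<Sum>z\<in>steps. \<Sum>s\<in>paths n. p z * (\<Prod>j<n. p (s ! j)))"
    by (simp add: sum_paths_Suc prod.lessThan_Suc_shift del: prod.lessThan_Suc)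
  also have "\<dots> = sum p steps * (\<Sum>s\<in>paths n. \<Prod>j<n. p (s ! j))"
    by (simp only: sum_product)
  finally show ?case using Suc.IH by simp
qed simp

text \<open>Variances of independent centred steps add up. The offset \<open>c\<close> lets the
  induction absorb the first centred step, and the cross terms vanish because that step has mean
  zero.\<close>

lemma sum_paths_variance:
  fixes p :: "int^'d::finite \<Rightarrow> real"
  assumes p1: "sum p steps = 1"
  defines "m \<equiv> (\<Sum>z\<in>steps. p z *\<^sub>R to_real_vec z)"
  shows "(\<Sum>s\<in>paths n. (\<Prod>j<n. p (s ! j)) * (norm (c + to_real_vec (sum_list s) - real n *\<^sub>R m))\<^sup>2)
     = (norm c)\<^sup>2 + real n * (\<Sum>z\<in>steps. p z * (norm (to_real_vec z - m))\<^sup>2)"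
proof (induction n arbitrary: c)
  case (Suc n)
  let ?v = "\<Sum>z\<in>steps. p z * (norm (to_real_vec z - m))\<^sup>2"
  have m: "(\<Sum>z\<in>steps. p z *\<^sub>R (to_real_vec z - m)) = 0"
    by (simp add: scaleR_diff_right sum_subtractf p1 m_def flip: scaleR_sum_left)
  have "(\<Sum>s\<in>paths (Suc n). (\<Prod>j<Suc n. p (s ! j)) * (norm (c + to_real_vec (sum_list s) - real (Suc n) *\<^sub>R m))\<^sup>2)
    = (\<Sum>z\<in>steps. p z * (\<Sum>s\<in>paths n. (\<Prod>j<n. p (s ! j)) *
        (norm ((c + (to_real_vec z - m)) + to_real_vec (sum_list s) - real n *\<^sub>R m))\<^sup>2))"
    by (simp add: sum_paths_Suc prod.lessThan_Suc_shift sum_distrib_left mult.assoc algebra_simps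
         del: prod.lessThan_Suc)
  also have "\<dots> = (\<Sum>z\<in>steps. p z * ((norm (c + (to_real_vec z - m)))\<^sup>2 + real n * ?v))"
    by (simp only: Suc.IH)
  also have "\<dots> = (\<Sum>z\<in>steps. p z * (norm c)\<^sup>2 + 2 * (c \<bullet> (p z *\<^sub>R (to_real_vec z - m)))
      + p z * (norm (to_real_vec z - m))\<^sup>2 + p z * (real n * ?v))"
    by (intro sum.cong refl) (simp add: power2_norm_eq_inner inner_add_left inner_add_right
        inner_commute algebra_simps)
  also have "\<dots> = (norm c)\<^sup>2 + real (Suc n) * ?v"
  proof -
    have "(\<Sum>z\<in>steps. p z * (norm c)\<^sup>2) = (norm c)\<^sup>2"
      and "(\<Sum>z\<in>steps. p z * (real n * ?v)) = real n * ?v"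
      using p1 by (simp_all flip: sum_distrib_right)
    moreover have "(\<Sum>z\<in>steps. 2 * (c \<bullet> (p z *\<^sub>R (to_real_vec z - m)))) = 0"
      unfolding sum_distrib_left[symmetric] inner_sum_right[symmetric] m by simp
    ultimately show ?thesis by (simp only: sum.distrib) (simp add: algebra_simps)
  qed
  finally show ?case .
qed simp

lemma eln_mono: "0 \<le> p \<Longrightarrow> p \<le> p' \<Longrightarrow> eln p \<le> eln p'"
  by (auto simp: eln_def)

lemma one_plus_less_exp: assumes "x \<noteq> 0" shows "1 + x < exp (x::real)"
proof (cases "x < -2")
  case True
  then show ?thesis using exp_gt_zero[of x] by linarith
next
  case False
  \<comment> \<open>Squaring the weak inequality at \<open>x / 2\<close> gains the strictly positive
    \<open>x\<^sup>2 / 4\<close>; monotonicity of the square needs \<open>1 + x / 2 \<ge> 0\<close>,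
    hence the case split at -2.\<close>
  have "0 < (x / 2)\<^sup>2" using assms by simp
  then have "1 + x < (1 + x / 2)\<^sup>2" by (simp add: power2_sum)
  also have "\<dots> \<le> (exp (x / 2))\<^sup>2" using False by (intro power_mono exp_ge_add_one_self) auto
  also have "\<dots> = exp x" by (simp add: power2_eq_square flip: exp_add)
  finally show ?thesis .
qed

section \<open>A superharmonic function for the difference walk\<close>

text \<open>The constant 11/64 slightly exceeds the Taylor coefficient 5/32. Below it is multiplied by 4 and
  competes with \<open>CARD('d) / 4 \<ge> 3/4\<close>; the margin absorbs the tilting factor 1.04.\<close>
lemma powr_minus_quarter_le:
  fixes t :: real
  assumes "\<bar>t\<bar> \<le> 1/10"
  shows "(1 + t) powr (-1/4) \<le> 1 - t/4 + 11/64 * t^2"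
proof -
  define a where "a = 1 - t/4 + 11/64 * t^2"
  have t: "t \<le> 1/10" "- (1/10) \<le> t" using assms by auto
  have a: "a > 0"
  proof -
    have "t^2 \<ge> 0" by simp
    then show ?thesis using t unfolding a_def by linarith
  qed
  have pw: "\<bar>t^k\<bar> \<le> (1/10)^k" for k
    unfolding power_abs by (rule power_mono) (use assms in auto)
  define R where "R = 1/16 + 31/64 * t - 549/2048 * t^2 + 863/4096 * t^3
     - 4455/65536 * t^4 + 6897/262144 * t^5 - 70543/16777216 * t^6 + 14641/16777216 * t^7"
  \<comment> \<open>The fourth power removes the root. The constant term 1/16 of \<open>R\<close> is
    \<open>4 * (11/64 - 5/32)\<close>; this margin dominates the higher terms for small
    \<open>t\<close>.\<close>
  have "(1 + t) * a^4 = 1 + t^2 * R"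
    unfolding a_def R_def by (simp add: field_simps power2_eq_square power3_eq_cube eval_nat_numeral)
  moreover have "t^2 \<le> 1/100" "- 1/1000 \<le> t^3" "t^4 \<le> 1/10000" "- 1/100000 \<le> t^5"
    "t^6 \<le> 1/1000000" "- 1/10000000 \<le> t^7"
    using pw[of 2] pw[of 3] pw[of 4] pw[of 5] pw[of 6] pw[of 7]
    by (auto simp: abs_le_iff power_divide)
  then have "R \<ge> 0"
    unfolding R_def using t by linarith
  ultimately have "1 \<le> (1 + t) * a^4" by simp
  then have "1 / (1 + t) \<le> a^4" using t by (simp add: field_simps)
  then have "(1 / (1 + t)) powr (1/4) \<le> (a^4) powr (1/4)"
    using t by (intro powr_mono2) auto
  also have "(a^4) powr (1/4) = a" using a by (simp add: powr_powr flip: powr_numeral)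
  also have "(1 / (1 + t)) powr (1/4) = (1 + t) powr (-1/4)"
    using t by (simp add: powr_divide powr_minus_divide)
  finally show ?thesis unfolding a_def .
qed

text \<open>Expansion to second order about \<open>u0\<close>: relative to
  \<open>u0 powr (-1/4)\<close>, the mean increment lowers the average by at least
  \<open>m / (4 * u0)\<close> and the second moment raises it by at most
  \<open>11/64 * v / u0\<close>. Both are of order \<open>1 / u0\<close>, so comparing
  \<open>m\<close> with \<open>v\<close> decides for every \<open>u0\<close>.\<close>

lemma lyapunov_step:
  fixes u s :: "'a \<Rightarrow> real" and p :: "'a \<Rightarrow> real" and \<kappa> :: real
  assumes S: "finite S" and p: "\<And>z. z \<in> S \<Longrightarrow> p z \<ge> 0" "sum p S = 1"
    and u: "u0 > 0" and s: "\<And>z. z \<in> S \<Longrightarrow> \<bar>s z\<bar> \<le> u0 / 10"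
    and m1: "(\<Sum>z\<in>S. p z * s z) \<ge> m" and m2: "(\<Sum>z\<in>S. p z * (s z)^2) \<le> v * u0"
    and mv: "11/64 * v \<le> m / 4"
  shows "(\<Sum>z\<in>S. p z * (u0 + s z) powr (-1/4)) \<le> u0 powr (-1/4)"
proof -
  have *: "(u0 + s z) powr (-1/4) \<le> u0 powr (-1/4) * (1 - s z / u0 / 4 + 11/64 * (s z / u0)^2)"
    if "z \<in> S" for z
  proof -
    have b: "\<bar>s z / u0\<bar> \<le> 1/10" using s[OF that] u by (simp add: field_simps abs_divide)
    have "u0 + s z = u0 * (1 + s z / u0)" using u by (simp add: field_simps)
    then have "(u0 + s z) powr (-1/4) = u0 powr (-1/4) * (1 + s z / u0) powr (-1/4)"
      using u b by (simp only: powr_mult)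
    also have "\<dots> \<le> u0 powr (-1/4) * (1 - s z / u0 / 4 + 11/64 * (s z / u0)^2)"
      by (intro mult_left_mono powr_minus_quarter_le b) auto
    finally show ?thesis .
  qed
  have "(\<Sum>z\<in>S. p z * (u0 + s z) powr (-1/4)) \<le>
     (\<Sum>z\<in>S. p z * (u0 powr (-1/4) * (1 - s z / u0 / 4 + 11/64 * (s z / u0)^2)))"
    by (intro sum_mono mult_left_mono * p)
  also have "\<dots> = u0 powr (-1/4) * (sum p S - (\<Sum>z\<in>S. p z * s z) / u0 / 4
      + 11/64 * (\<Sum>z\<in>S. p z * (s z)^2) / u0^2)"
    by (simp add: sum_distrib_left sum_distrib_right sum.distrib sum_subtractf algebra_simps
        power2_eq_square sum_divide_distrib)
  also have "\<dots> \<le> u0 powr (-1/4) * (1 - m / u0 / 4 + 11/64 * (v * u0) / u0^2)"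
    unfolding p using u m1 m2
    by (intro mult_left_mono add_mono diff_mono divide_right_mono) auto
  also have "11/64 * (v * u0) / u0^2 = (11/64 * v) / u0" using u by (simp add: power2_eq_square)
  also have "u0 powr (-1/4) * (1 - m / u0 / 4 + 11/64 * v / u0) \<le> u0 powr (-1/4) * 1"
  proof (intro mult_left_mono)
    have "11/64 * v / u0 \<le> m / 4 / u0" using mv u by (intro divide_right_mono) auto
    then show "1 - m / u0 / 4 + 11/64 * v / u0 \<le> 1" by simp
  qed auto
  finally show ?thesis by simp
qed

text \<open>\<open>A\<close> is the covariance of the difference of two independent
  \<open>q\<close>-steps, \<open>B\<close> its inverse, and \<open>g x\<close> is
  \<open>(b + B x \<bullet> x) powr (-1/4)\<close>. Up to the tolerance 1.04, a step raises the
  quadratic form by \<open>CARD('d)\<close> on average. That tolerance is admissible since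
  \<open>1.04^2 \<le> 12/11\<close>, the ratio of the gain 3/4 to the loss \<open>4 * 11/64\<close>.
  One \<open>g\<close> serves all kernels \<open>p\<close>, hence all small tilts at once.\<close>

lemma lyapunov_function:
  fixes q :: "int^'d::finite \<Rightarrow> real"
  assumes d: "CARD('d) \<ge> 3" and q: "\<And>z. z \<in> steps \<Longrightarrow> q z > 0" and q1: "sum q steps = 1"
  obtains g :: "real^'d \<Rightarrow> real" where "\<And>x. g x > 0" "\<And>x. x \<noteq> 0 \<Longrightarrow> g x < g 0"
    "\<And>p x. \<lbrakk>\<And>z w. z \<in> steps \<Longrightarrow> w \<in> steps \<Longrightarrow> p z w = p w z;
      \<And>z w. z \<in> steps \<Longrightarrow> w \<in> steps \<Longrightarrow> q z * q w / 1.04 \<le> p z w \<and> p z w \<le> 1.04 * (q z * q w);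
      (\<Sum>z\<in>steps. \<Sum>w\<in>steps. p z w) = 1\<rbrakk>
      \<Longrightarrow> (\<Sum>z\<in>steps. \<Sum>w\<in>steps. p z w * g (x + to_real_vec z - to_real_vec w)) \<le> g x"
proof -
  define D where "D = (\<lambda>z w :: int^'d. to_real_vec z - to_real_vec w)"
  have D_swap: "D w z = - D z w" for z w by (simp add: D_def)
  define A :: "real^'d \<Rightarrow> real^'d" where
    "A = (\<lambda>u. \<Sum>z\<in>steps. \<Sum>w\<in>steps. (q z * q w * (D z w \<bullet> u)) *\<^sub>R D z w)"
  have linA: "linear A"
    by (auto intro!: linearI simp: A_def inner_add_right algebra_simps sum.distrib scaleR_sum_right)
  have Ainner: "A u \<bullet> v = (\<Sum>z\<in>steps. \<Sum>w\<in>steps. q z * q w * (D z w \<bullet> u) * (D z w \<bullet> v))" for u v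
    by (simp add: A_def inner_sum_left)
  have Asym: "A u \<bullet> v = A v \<bullet> u" for u v
    unfolding Ainner by (simp add: mult_ac)
  have Apos: "A u \<bullet> u > 0" if nz: "u \<noteq> 0" for u
  proof -
    obtain i where i: "u $ i \<noteq> 0" using nz unfolding vec_eq_iff by auto
    let ?F = "\<lambda>z w. q z * q w * (D z w \<bullet> u) * (D z w \<bullet> u)"
    have nn: "?F z w \<ge> 0" if "z \<in> steps" "w \<in> steps" for z w
      using q[OF that(1)] q[OF that(2)] by (simp add: mult.assoc)
    \<comment> \<open>Opposite steps differ by twice a unit vector, so this single pair already
      detects the nonzero coordinate.\<close>
    have "0 < ?F (axis i 1) (axis i (-1))"
      using i q[OF axis_in_steps(1)[of i]] q[OF axis_in_steps(2)[of i]]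
      by (simp add: D_def inner_diff_left inner_axis' mult.assoc zero_less_mult_iff)
         (metis linorder_neqE_linordered_idom)
    also have "\<dots> \<le> (\<Sum>w\<in>steps. ?F (axis i 1) w)"
      by (rule member_le_sum[of "axis i (-1)"]) (use nn axis_in_steps in auto)
    also have "\<dots> \<le> (\<Sum>z\<in>steps. \<Sum>w\<in>steps. ?F z w)"
      by (rule member_le_sum[of "axis i 1" _ "\<lambda>z. \<Sum>w\<in>steps. ?F z w"])
         (use nn axis_in_steps in \<open>auto intro!: sum_nonneg\<close>)
    finally show ?thesis unfolding Ainner .
  qed
  have "inj A"
    unfolding linear_injective_0[OF linA] using Apos by (metis inner_zero_left less_irrefl)
  then obtain B where B: "linear B" "\<And>x. B (A x) = x" "\<And>x. A (B x) = x"
    using linear_injective_isomorphism[OF linA] by metis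
  have Bsym: "B x \<bullet> y = B y \<bullet> x" for x y
    using Asym[of "B x" "B y"] B(3) by (simp add: inner_commute)
  have Bpos: "B x \<bullet> x > 0" if "x \<noteq> 0" for x
  proof -
    have "B x \<noteq> 0" using that B(3) by (metis linA linear_0)
    then show ?thesis using Apos[of "B x"] B(3) by (simp add: inner_commute)
  qed
  have Bnn: "B x \<bullet> x \<ge> 0" for x
    using Bpos[of x] by (cases "x = 0") auto
  have Badd: "B (x + y) = B x + B y" for x y using B(1) by (simp add: linear_add)
  have Bscale: "B (c *\<^sub>R y) = c *\<^sub>R B y" for c y using B(1) by (simp add: linear_scale)
  have Bquad: "B (x + y) \<bullet> (x + y) = B x \<bullet> x + 2 * (B x \<bullet> y) + B y \<bullet> y" for x y
    using Bsym[of x y] by (simp add: Badd inner_add_left inner_add_right)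
  have CS: "(B x \<bullet> y)^2 \<le> (B x \<bullet> x) * (B y \<bullet> y)" for x y
  proof (cases "x = 0")
    case True then show ?thesis using B(1) by (simp add: linear_0)
  next
    case False
    define a where "a = B x \<bullet> x"
    have a: "a > 0" using Bpos[OF False] by (simp add: a_def)
    define c where "c = B x \<bullet> y"
    have "0 \<le> B ((- (c / a)) *\<^sub>R x + y) \<bullet> ((- (c / a)) *\<^sub>R x + y)" by (rule Bnn)
    also have "\<dots> = (c/a)^2 * a - 2 * (c/a) * c + B y \<bullet> y"
      unfolding Bquad by (simp only: Bscale inner_scaleR_left inner_scaleR_right)
        (simp add: a_def c_def power2_eq_square)
    also have "\<dots> = B y \<bullet> y - c^2 / a" using a by (simp add: power2_eq_square field_simps)
    finally show ?thesis using a by (simp add: field_simps a_def c_def)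
  qed
  \<comment> \<open>The trace of \<open>A\<close> composed with its inverse, hence of the identity:
    expand the form in coordinates and exchange the sums.\<close>
  have trace: "(\<Sum>z\<in>steps. \<Sum>w\<in>steps. q z * q w * (B (D z w) \<bullet> D z w)) = CARD('d)"
  proof -
    have "B (D z w) \<bullet> D z w = (\<Sum>i\<in>UNIV. (D z w \<bullet> B (axis i 1)) * (D z w \<bullet> axis i 1))" for z w
      unfolding inner_vec_def[of "B (D z w)"]
    proof (rule sum.cong)
      fix i
      have "B (D z w) $ i = B (D z w) \<bullet> axis i 1" by (simp add: inner_axis)
      also have "\<dots> = D z w \<bullet> B (axis i 1)" by (subst Bsym) (rule inner_commute)
      finally show "B (D z w) $ i \<bullet> D z w $ i = (D z w \<bullet> B (axis i 1)) * (D z w \<bullet> axis i 1)"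
        by (simp add: inner_axis)
    qed simp
    then have "(\<Sum>z\<in>steps. \<Sum>w\<in>steps. q z * q w * (B (D z w) \<bullet> D z w))
      = (\<Sum>z\<in>steps. \<Sum>w\<in>steps. \<Sum>i\<in>UNIV. q z * q w * (D z w \<bullet> B (axis i 1)) * (D z w \<bullet> axis i 1))"
      by (simp add: sum_distrib_left mult.assoc)
    also have "\<dots> = (\<Sum>z\<in>steps. \<Sum>i\<in>UNIV. \<Sum>w\<in>steps. q z * q w * (D z w \<bullet> B (axis i 1)) * (D z w \<bullet> axis i 1))"
      by (intro sum.cong sum.swap refl)
    also have "\<dots> = (\<Sum>i\<in>UNIV. \<Sum>z\<in>steps. \<Sum>w\<in>steps. q z * q w * (D z w \<bullet> B (axis i 1)) * (D z w \<bullet> axis i 1))"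
      by (rule sum.swap)
    also have "\<dots> = (\<Sum>i\<in>UNIV. A (B (axis i 1)) \<bullet> (axis i 1 :: real^'d))"
      unfolding Ainner ..
    also have "\<dots> = CARD('d)" by (simp add: B(3) inner_axis_axis)
    finally show ?thesis .
  qed
  \<comment> \<open>Including 1 in the maximum gives \<open>K \<le> K^2\<close>, so
    \<open>K^2\<close> dominates both the quadratic part of an increment and its square.\<close>
  define K where "K = Max (insert 1 ((\<lambda>(z,w). B (D z w) \<bullet> D z w) ` (steps \<times> steps)))"
  have K1: "K \<ge> 1" unfolding K_def by (intro Max_ge) auto
  have K: "B (D z w) \<bullet> D z w \<le> K" if "z \<in> steps" "w \<in> steps" for z w
    unfolding K_def using that by (intro Max_ge) auto
  \<comment> \<open>Since \<open>1600 = 40^2\<close>, Cauchy-Schwarz gives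
    \<open>\<bar>B x \<bullet> D z w\<bar> \<le> u x / 40\<close>; an increment of \<open>u\<close>
    is then at most \<open>u x / 20 + u x / 1600\<close>, inside the range \<open>u x / 10\<close>
    of the Taylor bound. The same \<open>b\<close> absorbs the term \<open>K^2\<close> of the second
    moment.\<close>
  define b where "b = 1600 * K^2"
  define u where "u = (\<lambda>x. b + B x \<bullet> x)"
  have KK: "K \<le> K^2" using K1 by (simp add: power2_eq_square)
  have b: "b > 0" using K1 by (simp add: b_def)
  have ub: "u x \<ge> b" for x using Bnn by (simp add: u_def)
  have up: "u x > 0" for x using ub[of x] b by linarith
  define g where "g = (\<lambda>x. u x powr (-1/4))"
  have "g x > 0" for x unfolding g_def using up[of x] by simp
  moreover have "g x < g 0" if "x \<noteq> 0" for x
    unfolding g_def using b Bpos[OF that] up[of 0]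
    by (intro powr_less_mono2_neg) (auto simp: u_def)
  moreover have "(\<Sum>z\<in>steps. \<Sum>w\<in>steps. p z w * g (x + to_real_vec z - to_real_vec w)) \<le> g x"
    if psym: "\<And>z w. z \<in> steps \<Longrightarrow> w \<in> steps \<Longrightarrow> p z w = p w z"
    and pq: "\<And>z w. z \<in> steps \<Longrightarrow> w \<in> steps \<Longrightarrow> q z * q w / 1.04 \<le> p z w \<and> p z w \<le> 1.04 * (q z * q w)"
    and p1: "(\<Sum>z\<in>steps. \<Sum>w\<in>steps. p z w) = 1" for p x
  proof -
    let ?SS = "steps \<times> steps :: ((int^'d) \<times> (int^'d)) set"
    let ?D = "\<lambda>(z,w). D z w" and ?p = "\<lambda>(z,w). p z w" and ?q = "\<lambda>(z,w). q z * q w"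
    define s where "s = (\<lambda>e. 2 * (B x \<bullet> ?D e) + B (?D e) \<bullet> ?D e)"
    \<comment> \<open>Exchanging the two walkers reverses their difference. This kills the linear
      term of the drift, by symmetry of \<open>p\<close>, and the cubic term of the second moment,
      where \<open>p\<close> has already been replaced by the symmetric
      \<open>q z * q w\<close>.\<close>
    have anti: "(\<Sum>e\<in>?SS. f e) = 0"
      if "\<And>z w. z \<in> steps \<Longrightarrow> w \<in> steps \<Longrightarrow> f (w,z) = - f (z,w)" for f :: "_ \<Rightarrow> real"
    proof -
      have "(\<Sum>e\<in>?SS. f e) = (\<Sum>e\<in>?SS. - f e)"

      proof (rule sum.reindex_bij_witness[of _ prod.swap prod.swap])
        fix e assume "e \<in> ?SS"
        then show "- f (prod.swap e) = f e" using that[of "snd e" "fst e"] by (auto simp: prod.swap_def)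
      qed auto
      then show ?thesis by (simp add: sum_negf)
    qed
    have pnn: "?p e \<ge> 0" "?q e \<ge> 0" if "e \<in> ?SS" for e
    proof -
      obtain z w where e: "e = (z,w)" "z \<in> steps" "w \<in> steps" using \<open>e \<in> ?SS\<close> by auto
      have "q z * q w > 0" using q e by simp
      then show "?p e \<ge> 0" "?q e \<ge> 0" using pq[OF e(2,3)] e(1) by auto
    qed
    have pq': "?q e / 1.04 \<le> ?p e" "?p e \<le> 1.04 * ?q e" if "e \<in> ?SS" for e using pq that by auto
    have q1': "sum ?q ?SS = 1"
    proof -
      have "sum ?q ?SS = (\<Sum>z\<in>steps. \<Sum>w\<in>steps. q z * q w)" by (simp add: sum.cartesian_product)
      also have "\<dots> = sum q steps * sum q steps" by (simp add: sum_product)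
      finally show ?thesis using q1 by simp
    qed
    have p1': "sum ?p ?SS = 1" using p1 by (simp add: sum.cartesian_product)
    have "(\<Sum>e\<in>?SS. ?p e * (u x + s e) powr (-1/4)) \<le> u x powr (-1/4)"
    proof (rule lyapunov_step[where m = "3 / 1.04" and v = "4 * 1.04"])
      fix e assume e: "e \<in> ?SS"
      let ?Q = "B (?D e) \<bullet> ?D e"
      have Q: "?Q \<le> K" "?Q \<ge> 0" using K e Bnn by auto
      have "(B x \<bullet> ?D e)^2 \<le> (B x \<bullet> x) * ?Q" by (rule CS)
      also have "\<dots> \<le> u x * K" using Q b Bnn[of x] up[of x]
        by (intro mult_mono) (auto simp: u_def)
      also have "\<dots> \<le> u x * (b / 1600)" using KK up[of x] by (simp add: b_def)
      also have "\<dots> \<le> u x * (u x / 1600)" using ub[of x] up[of x] by (intro mult_left_mono divide_right_mono) auto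
      also have "\<dots> = (u x / 40)^2" by (simp add: power2_eq_square)
      finally have "\<bar>B x \<bullet> ?D e\<bar> \<le> u x / 40"
        using up[of x] by (simp add: abs_le_square_iff[symmetric])
      moreover have "?Q \<le> u x / 1600"
        using Q KK ub[of x] by (simp add: b_def)
      ultimately show "\<bar>s e\<bar> \<le> u x / 10" unfolding s_def using Q(2) up[of x] by linarith
    next
      have "(\<Sum>e\<in>?SS. ?p e * s e) = (\<Sum>e\<in>?SS. 2 * (?p e * (B x \<bullet> ?D e))) + (\<Sum>e\<in>?SS. ?p e * (B (?D e) \<bullet> ?D e))"
        by (simp add: s_def algebra_simps sum.distrib)
      also have "(\<Sum>e\<in>?SS. 2 * (?p e * (B x \<bullet> ?D e))) = 0"
        by (rule anti) (use psym in \<open>simp add: D_def inner_diff_right algebra_simps\<close>)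
      also have "(\<Sum>e\<in>?SS. ?p e * (B (?D e) \<bullet> ?D e)) \<ge> (\<Sum>e\<in>?SS. ?q e / 1.04 * (B (?D e) \<bullet> ?D e))"
        by (intro sum_mono mult_right_mono pq' Bnn)
      moreover have "(\<Sum>e\<in>?SS. ?q e / 1.04 * (B (?D e) \<bullet> ?D e)) = CARD('d) / 1.04"
        unfolding trace[symmetric] sum.cartesian_product sum_divide_distrib by (rule sum.cong) (simp_all add: case_prod_beta)
      moreover have "CARD('d) / 1.04 \<ge> (3::real) / 1.04" using d by (intro divide_right_mono) auto
      ultimately show "3 / 1.04 \<le> (\<Sum>e\<in>?SS. ?p e * s e)" by linarith
    next
      have "(\<Sum>e\<in>?SS. ?p e * (s e)^2) \<le> (\<Sum>e\<in>?SS. 1.04 * ?q e * (s e)^2)"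
        by (intro sum_mono mult_right_mono pq') auto
      also have "\<dots> = 1.04 * (\<Sum>e\<in>?SS. ?q e * (s e)^2)" by (simp add: sum_distrib_left mult.assoc)
      also have "(\<Sum>e\<in>?SS. ?q e * (s e)^2) = 4 * (\<Sum>e\<in>?SS. ?q e * (B x \<bullet> ?D e)^2)
         + (\<Sum>e\<in>?SS. 4 * ?q e * (B x \<bullet> ?D e) * (B (?D e) \<bullet> ?D e)) + (\<Sum>e\<in>?SS. ?q e * (B (?D e) \<bullet> ?D e)^2)"
        unfolding sum_distrib_left sum.distrib[symmetric]
      proof (rule sum.cong)
        fix e
        define \<alpha> \<beta> \<gamma> where "\<alpha> = ?q e" "\<beta> = B x \<bullet> ?D e" "\<gamma> = B (?D e) \<bullet> ?D e"
        show "?q e * (s e)^2 = 4 * (?q e * (B x \<bullet> ?D e)^2) + 4 * ?q e * (B x \<bullet> ?D e) * (B (?D e) \<bullet> ?D e)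
            + ?q e * (B (?D e) \<bullet> ?D e)^2"
          unfolding s_def \<alpha>_\<beta>_\<gamma>_def[symmetric] by (simp add: power2_eq_square algebra_simps)
      qed simp
      also have "(\<Sum>e\<in>?SS. 4 * ?q e * (B x \<bullet> ?D e) * (B (?D e) \<bullet> ?D e)) = 0"
      proof (rule anti)
        fix z w :: "int^'d"
        have "B (D w z) \<bullet> D w z = B (D z w) \<bullet> D z w"
          using Bscale[of "-1" "D z w"] by (simp add: D_swap[of w z])
        moreover have "B x \<bullet> D w z = - (B x \<bullet> D z w)" by (simp add: D_swap[of w z])
        ultimately show "4 * ?q (w,z) * (B x \<bullet> ?D (w,z)) * (B (?D (w,z)) \<bullet> ?D (w,z)) =
          - (4 * ?q (z,w) * (B x \<bullet> ?D (z,w)) * (B (?D (z,w)) \<bullet> ?D (z,w)))" by (simp add: mult_ac)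
      qed
      also have "(\<Sum>e\<in>?SS. ?q e * (B x \<bullet> ?D e)^2) = B x \<bullet> x"
      proof -
        have "B x \<bullet> x = A (B x) \<bullet> B x" by (simp add: B(3) inner_commute)
        also have "\<dots> = (\<Sum>e\<in>?SS. ?q e * (B x \<bullet> ?D e)^2)"
          unfolding Ainner sum.cartesian_product
          by (rule sum.cong) (simp_all add: case_prod_beta power2_eq_square inner_commute[of "D _ _"] mult.assoc)
        finally show ?thesis ..
      qed
      also have "(\<Sum>e\<in>?SS. ?q e * (B (?D e) \<bullet> ?D e)^2) \<le> (\<Sum>e\<in>?SS. ?q e * K^2)"
        using K Bnn by (intro sum_mono mult_left_mono power_mono pnn) auto
      also have "\<dots> = K^2" using q1' by (simp flip: sum_distrib_right)
      also have "1.04 * (4 * (B x \<bullet> x) + 0 + K^2) \<le> 4 * 1.04 * u x"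
        using K1 by (simp add: u_def b_def)
      finally show "(\<Sum>e\<in>?SS. ?p e * (s e)^2) \<le> 4 * 1.04 * u x" by simp
    qed (use pnn p1' up in auto)
    also have "(\<Sum>e\<in>?SS. ?p e * (u x + s e) powr (-1/4)) =
       (\<Sum>z\<in>steps. \<Sum>w\<in>steps. p z w * g (x + to_real_vec z - to_real_vec w))"
    proof -
      have "u x + s (z,w) = u (x + to_real_vec z - to_real_vec w)" for z w
        using Bquad[of x "D z w"] by (simp add: u_def s_def D_def add_diff_eq)
      then show ?thesis
        unfolding sum.cartesian_product g_def by (intro sum.cong refl) auto
    qed
    finally show ?thesis by (simp add: g_def)
  qed
  ultimately show ?thesis using that by blast
qed

section \<open>McDiarmid's inequality\<close>

text \<open>The martingale difference argument with Fubini in place of conditional expectations: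
  integrating out coordinate \<open>i\<close> gives \<open>g\<close>, which inherits the bounds
  \<open>C\<close> and \<open>D\<close>, while \<open>F - g\<close> is centred in that coordinate.
  Hoeffding's lemma contributes one exponential factor per coordinate.\<close>

lemma PiM_bounded_difference_mgf:
  fixes F :: "('i \<Rightarrow> 'a) \<Rightarrow> real"
  assumes "finite I" and "\<And>i. prob_space (N i)" and "F \<in> borel_measurable (PiM I N)"
    and "\<And>x. x \<in> space (PiM I N) \<Longrightarrow> \<bar>F x\<bar> \<le> C"
    and "\<And>x i y. \<lbrakk>x \<in> space (PiM I N); i \<in> I; y \<in> space (N i)\<rbrakk> \<Longrightarrow> \<bar>F (x(i := y)) - F x\<bar> \<le> D"
    and l: "l > 0" and D: "D \<ge> 0"
  shows "(\<integral>\<^sup>+x. exp (l * (F x - integral\<^sup>L (PiM I N) F)) \<partial>PiM I N) \<le> exp (card I * (l^2 * D^2 / 2))"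
  using assms(1,3,4,5)
proof (induction I arbitrary: F rule: finite_induct)
  case empty
  interpret product_prob_space N "{}" by (intro product_prob_spaceI assms)
  have "F x = F (\<lambda>_. undefined)" if "x \<in> space (PiM {} N)" for x
    using that by (simp add: space_PiM_empty)
  then show ?case
    by (simp add: PiM_empty lebesgue_integral_count_space_finite nn_integral_count_space_finite)
next
  case (insert i J F)
  note F[measurable] = insert.prems(1)
  have C: "\<bar>F x\<bar> \<le> C" if "x \<in> space (PiM (insert i J) N)" for x using insert.prems(2) that .
  interpret J: prob_space "PiM J N" by (rule prob_space_PiM) (rule assms)
  interpret Ji: prob_space "PiM (insert i J) N" by (rule prob_space_PiM) (rule assms)
  interpret Ni: prob_space "N i" by (rule assms)
  interpret PP: product_prob_space N UNIV by (intro product_prob_spaceI assms)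
  have ext[measurable]: "(\<lambda>(x,y). x(i := y)) \<in> measurable (PiM J N \<Otimes>\<^sub>M N i) (PiM (insert i J) N)"
    by (rule measurable_add_dim)
  have ext_sp: "x(i := y) \<in> space (PiM (insert i J) N)" if "x \<in> space (PiM J N)" "y \<in> space (N i)" for x y
    using that by (auto simp: space_PiM PiE_iff extensional_def)
  have Fxy[measurable]: "(\<lambda>(x,y). F (x(i := y))) \<in> borel_measurable (PiM J N \<Otimes>\<^sub>M N i)"
    using measurable_compose[OF ext F] by (simp add: case_prod_beta')
  define g where "g = (\<lambda>x. \<integral>y. F (x(i := y)) \<partial>N i)"
  have g[measurable]: "g \<in> borel_measurable (PiM J N)"
    unfolding g_def by measurable
  have Fx[measurable]: "(\<lambda>y. F (x(i := y))) \<in> borel_measurable (N i)" if "x \<in> space (PiM J N)" for x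
    using measurable_Pair2[OF Fxy that] by simp
  have int_Fx: "integrable (N i) (\<lambda>y. F (x(i := y)))" if "x \<in> space (PiM J N)" for x
    by (rule Ni.integrable_const_bound[where B = C]) (use that Fx C ext_sp in \<open>auto intro!: AE_I2\<close>)
  have int_F: "integrable (PiM (insert i J) N) F"
    by (rule Ji.integrable_const_bound[where B = C]) (use C in \<open>auto intro!: AE_I2\<close>)
  have EF: "integral\<^sup>L (PiM (insert i J) N) F = integral\<^sup>L (PiM J N) g"
    unfolding g_def by (rule PP.product_integral_insert) (use insert.hyps int_F in auto)
  let ?m = "integral\<^sup>L (PiM J N) g"
  have gC: "\<bar>g x\<bar> \<le> C" if x: "x \<in> space (PiM J N)" for x
  proof -
    have "\<bar>g x\<bar> \<le> (\<integral>y. \<bar>F (x(i := y))\<bar> \<partial>N i)" unfolding g_def by (rule integral_abs_bound)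
    also have "\<dots> \<le> (\<integral>y. C \<partial>N i)"
      using int_Fx[OF x] C ext_sp[OF x] by (intro integral_mono) auto
    finally show ?thesis by (simp add: Ni.prob_space)
  qed
  have gD: "\<bar>g (x(j := y)) - g x\<bar> \<le> D" if x: "x \<in> space (PiM J N)" and j: "j \<in> J" and y: "y \<in> space (N j)" for x j y
  proof -
    have x': "x(j := y) \<in> space (PiM J N)"
      using x y j by (auto simp: space_PiM PiE_iff extensional_def)
    have ij: "j \<noteq> i" using insert.hyps j by auto
    have b: "\<bar>F ((x(j := y))(i := w)) - F (x(i := w))\<bar> \<le> D" if "w \<in> space (N i)" for w
    proof -
      have "(x(i := w))(j := y) = (x(j := y))(i := w)" using ij by auto
      then show ?thesis using insert.prems(3)[OF ext_sp[OF x that] insertI2[OF j] y] by (simp only:)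
    qed
    have "g (x(j := y)) - g x = (\<integral>w. F ((x(j := y))(i := w)) - F (x(i := w)) \<partial>N i)"
      unfolding g_def by (rule Bochner_Integration.integral_diff[symmetric]) (use int_Fx x x' in auto)
    also have "\<bar>\<dots>\<bar> \<le> (\<integral>w. \<bar>F ((x(j := y))(i := w)) - F (x(i := w))\<bar> \<partial>N i)"
      by (rule integral_abs_bound)
    also have "\<dots> \<le> (\<integral>w. D \<partial>N i)"
      using int_Fx[OF x] int_Fx[OF x'] b by (intro integral_mono) auto
    finally show ?thesis by (simp add: Ni.prob_space)
  qed
  have IH: "(\<integral>\<^sup>+x. exp (l * (g x - ?m)) \<partial>PiM J N) \<le> exp (card J * (l^2 * D^2 / 2))"
    using insert.IH[OF g gC gD] by simp
  have inner: "(\<integral>\<^sup>+y. exp (l * (F (x(i := y)) - ?m)) \<partial>N i) \<le> ennreal (exp (l^2 * D^2 / 2)) * exp (l * (g x - ?m))"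
    if x: "x \<in> space (PiM J N)" for x
  proof -
    define f where "f = (\<lambda>y. F (x(i := y)) - g x)"
    obtain y0 where y0: "y0 \<in> space (N i)" using Ni.not_empty by auto
    \<comment> \<open>An interval around the value at a reference point; its length
      \<open>2 * D\<close> turns Hoeffding's exponent \<open>l^2 * (b - a)^2 / 8\<close> into
      \<open>l^2 * D^2 / 2\<close>.\<close>
    define a b where "a = F (x(i := y0)) - g x - D" and "b = F (x(i := y0)) - g x + D"
    have f[measurable]: "f \<in> borel_measurable (N i)" unfolding f_def using Fx[OF x] by simp
    have fab: "f y \<in> {a..b}" if y: "y \<in> space (N i)" for y
    proof -
      have "\<bar>F ((x(i := y0))(i := y)) - F (x(i := y0))\<bar> \<le> D"
        by (rule insert.prems(3)[OF ext_sp[OF x y0]]) (use y in auto)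
      then show ?thesis by (auto simp: f_def a_def b_def)
    qed
    interpret interval_bounded_random_variable "N i" f a b
      by unfold_locales (use fab in auto)
    have "Ni.expectation f = 0"
      unfolding f_def using int_Fx[OF x] by (simp add: g_def Ni.prob_space)
    from Hoeffdings_lemma_nn_integral_0[OF l this]
    have *: "(\<integral>\<^sup>+y. ennreal (exp (l * f y)) \<partial>N i) \<le> ennreal (exp (l^2 * D^2 / 2))"
      by (simp add: a_def b_def power2_eq_square mult_ac)
    have "(\<integral>\<^sup>+y. exp (l * (F (x(i := y)) - ?m)) \<partial>N i) = (\<integral>\<^sup>+y. ennreal (exp (l * f y)) * exp (l * (g x - ?m)) \<partial>N i)"
      by (simp add: f_def algebra_simps flip: ennreal_mult exp_add)
    also have "\<dots> = (\<integral>\<^sup>+y. ennreal (exp (l * f y)) \<partial>N i) * exp (l * (g x - ?m))"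
      by (rule nn_integral_multc) auto
    also have "\<dots> \<le> ennreal (exp (l^2 * D^2 / 2)) * exp (l * (g x - ?m))"
      by (intro mult_right_mono *) auto
    finally show ?thesis .
  qed
  have "(\<integral>\<^sup>+x. exp (l * (F x - integral\<^sup>L (PiM (insert i J) N) F)) \<partial>PiM (insert i J) N)
    = (\<integral>\<^sup>+x. \<integral>\<^sup>+y. exp (l * (F (x(i := y)) - ?m)) \<partial>N i \<partial>PiM J N)"
    unfolding EF by (rule PP.product_nn_integral_insert) (use insert.hyps in auto)
  also have "\<dots> \<le> (\<integral>\<^sup>+x. ennreal (exp (l^2 * D^2 / 2)) * exp (l * (g x - ?m)) \<partial>PiM J N)"
    by (intro nn_integral_mono inner)
  also have "\<dots> = ennreal (exp (l^2 * D^2 / 2)) * (\<integral>\<^sup>+x. exp (l * (g x - ?m)) \<partial>PiM J N)"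
    by (rule nn_integral_cmult) auto
  also have "\<dots> \<le> ennreal (exp (l^2 * D^2 / 2)) * exp (card J * (l^2 * D^2 / 2))"
    by (intro mult_left_mono IH) auto
  also have "\<dots> = exp (card (insert i J) * (l^2 * D^2 / 2))"
    using insert.hyps by (simp add: algebra_simps flip: ennreal_mult exp_add)
  finally show ?case .
qed

text \<open>Independence makes the joint law of the \<open>X i\<close> the product of the marginals,
  where the exponential moment is already controlled; Markov's inequality then gives the
  tail.\<close>

lemma (in prob_space) mcdiarmid_upper:
  fixes F :: "('i \<Rightarrow> 'b) \<Rightarrow> real" and X :: "'i \<Rightarrow> 'a \<Rightarrow> 'b" and D t :: real
  assumes I: "finite I" "I \<noteq> {}" and ind: "indep_vars N X I" and F: "F \<in> borel_measurable (PiM I N)"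
    and C: "\<And>x. x \<in> space (PiM I N) \<Longrightarrow> \<bar>F x\<bar> \<le> C"
    and FD: "\<And>x i y. \<lbrakk>x \<in> space (PiM I N); i \<in> I; y \<in> space (N i)\<rbrakk> \<Longrightarrow> \<bar>F (x(i := y)) - F x\<bar> \<le> D"
    and D: "D > 0" and t: "t > 0"
  defines "f \<equiv> (\<lambda>\<omega>. F (\<lambda>i\<in>I. X i \<omega>))"
  shows "prob {\<omega>\<in>space M. f \<omega> - expectation f \<ge> t} \<le> exp (- (t^2 / (2 * card I * D^2)))"
proof -
  note [measurable] = F
  have X[measurable]: "X i \<in> measurable M (N i)" if "i \<in> I" for i
    using ind that by (auto simp: indep_vars_def)
  obtain i0 where i0: "i0 \<in> I" using I by auto
  \<comment> \<open>Outside \<open>I\<close> an arbitrary marginal is the default, because the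
    product bound asks for a probability measure at every index.\<close>
  define N' where "N' = (\<lambda>i. if i \<in> I then distr M (N i) (X i) else distr M (N i0) (X i0))"
  have N': "prob_space (N' i)" for i
    unfolding N'_def using i0 by (auto intro!: prob_space_distr)
  have PiM': "PiM I N' = PiM I (\<lambda>i. distr M (N i) (X i))"
    by (rule PiM_cong) (auto simp: N'_def)
  have sets_eq: "sets (PiM I N') = sets (PiM I N)"
    by (rule sets_PiM_cong) (auto simp: N'_def)
  have space_eq: "space (PiM I N') = space (PiM I N)"
    using sets_eq by (rule sets_eq_imp_space_eq)
  have dist: "distr M (PiM I N) (\<lambda>\<omega>. \<lambda>i\<in>I. X i \<omega>) = PiM I N'"
    unfolding PiM' using indep_vars_iff_distr_eq_PiM'[OF I(2), of X N] X ind by auto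
  have XI[measurable]: "(\<lambda>\<omega>. \<lambda>i\<in>I. X i \<omega>) \<in> measurable M (PiM I N)"
    by (rule measurable_restrict[OF X])
  have f[measurable]: "f \<in> borel_measurable M" unfolding f_def by (rule measurable_compose[OF XI F])
  \<comment> \<open>The minimiser of \<open>- l * t + card I * (l^2 * D^2 / 2)\<close>.\<close>
  define l where "l = t / (card I * D^2)"
  have cI: "card I > 0" using I by auto
  have l: "l > 0" using t D cI by (simp add: l_def)
  have Ef: "expectation f = integral\<^sup>L (PiM I N') F"
    unfolding dist[symmetric] f_def by (rule integral_distr[OF XI F, symmetric])
  have mgf: "(\<integral>\<^sup>+\<omega>. exp (l * (f \<omega> - expectation f)) \<partial>M) \<le> exp (card I * (l^2 * D^2 / 2))"
  proof -
    have "(\<integral>\<^sup>+\<omega>. exp (l * (f \<omega> - expectation f)) \<partial>M) = (\<integral>\<^sup>+x. exp (l * (F x - expectation f)) \<partial>PiM I N')"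
      unfolding dist[symmetric] f_def by (rule nn_integral_distr[OF XI, symmetric]) simp
    also have "\<dots> \<le> exp (card I * (l^2 * D^2 / 2))"
      unfolding Ef
    proof (rule PiM_bounded_difference_mgf[where C = C])
      show "F \<in> borel_measurable (PiM I N')"
        using F by (simp add: measurable_cong_sets[OF sets_eq refl])
      show "\<bar>F (x(i := y)) - F x\<bar> \<le> D" if "x \<in> space (PiM I N')" "i \<in> I" "y \<in> space (N' i)" for x i y
        using FD[of x i y] that space_eq by (auto simp: N'_def)
    qed (use I N' C l D space_eq in auto)
    finally show ?thesis .
  qed
  have "emeasure M {\<omega>\<in>space M. f \<omega> - expectation f \<ge> t}
     \<le> emeasure M ({\<omega>\<in>space M. 1 \<le> ennreal (exp (- l * t)) * ennreal (exp (l * (f \<omega> - expectation f)))})"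
  proof (intro emeasure_mono subsetI)
    fix \<omega> assume "\<omega> \<in> {\<omega>\<in>space M. f \<omega> - expectation f \<ge> t}"
    then have "1 \<le> exp (- l * t + l * (f \<omega> - expectation f))" "\<omega> \<in> space M"
      using l by (auto simp flip: right_diff_distrib)
    then show "\<omega> \<in> {\<omega>\<in>space M. 1 \<le> ennreal (exp (- l * t)) * ennreal (exp (l * (f \<omega> - expectation f)))}"
      by (simp flip: ennreal_mult exp_add)
  qed auto
  also have "\<dots> \<le> ennreal (exp (- l * t)) * (\<integral>\<^sup>+\<omega>. ennreal (exp (l * (f \<omega> - expectation f))) * indicator (space M) \<omega> \<partial>M)"
    by (rule nn_integral_Markov_inequality) auto
  also have "(\<integral>\<^sup>+\<omega>. ennreal (exp (l * (f \<omega> - expectation f))) * indicator (space M) \<omega> \<partial>M)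
     = (\<integral>\<^sup>+\<omega>. ennreal (exp (l * (f \<omega> - expectation f))) \<partial>M)"
    by (rule nn_integral_cong) simp
  also have "ennreal (exp (- l * t)) * \<dots> \<le> ennreal (exp (- l * t)) * exp (card I * (l^2 * D^2 / 2))"
    by (intro mult_left_mono mgf) auto
  also have "\<dots> = exp (- l * t + card I * (l^2 * D^2 / 2))"
    by (simp flip: ennreal_mult exp_add)
  also have "- l * t + card I * (l^2 * D^2 / 2) = - (t^2 / (2 * card I * D^2))"
    using cI D by (simp add: l_def field_simps power2_eq_square)
  finally show ?thesis by (simp add: emeasure_eq_measure)
qed

lemma (in prob_space) mcdiarmid_lower:
  fixes F :: "('i \<Rightarrow> 'b) \<Rightarrow> real" and X :: "'i \<Rightarrow> 'a \<Rightarrow> 'b" and D t :: real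
  assumes I: "finite I" "I \<noteq> {}" and ind: "indep_vars N X I" and F: "F \<in> borel_measurable (PiM I N)"
    and C: "\<And>x. x \<in> space (PiM I N) \<Longrightarrow> \<bar>F x\<bar> \<le> C"
    and FD: "\<And>x i y. \<lbrakk>x \<in> space (PiM I N); i \<in> I; y \<in> space (N i)\<rbrakk> \<Longrightarrow> \<bar>F (x(i := y)) - F x\<bar> \<le> D"
    and D: "D > 0" and t: "t > 0"
  defines "f \<equiv> (\<lambda>\<omega>. F (\<lambda>i\<in>I. X i \<omega>))"
  shows "prob {\<omega>\<in>space M. f \<omega> - expectation f \<le> - t} \<le> exp (- (t^2 / (2 * card I * D^2)))"
proof -
  have "prob {\<omega>\<in>space M. - f \<omega> - expectation (\<lambda>\<omega>. - f \<omega>) \<ge> t} \<le> exp (- (t^2 / (2 * card I * D^2)))"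
    unfolding f_def
    by (rule mcdiarmid_upper[where F = "\<lambda>x. - F x" and N = N and C = C])
       (use I ind F C FD D t in \<open>auto simp: abs_minus_commute\<close>)
  moreover have "expectation (\<lambda>\<omega>. - f \<omega>) = - expectation f"
    by (rule Bochner_Integration.integral_minus)
  moreover have "{\<omega>\<in>space M. f \<omega> - expectation f \<le> - t} = {\<omega>\<in>space M. - f \<omega> - (- expectation f) \<ge> t}"
    by auto
  ultimately show ?thesis by simp
qed

section \<open>Clamped environments and path probabilities\<close>

definition good_row :: "real \<Rightarrow> (int^'d::finite \<Rightarrow> real) \<Rightarrow> bool" where
  "good_row c v \<longleftrightarrow> (\<Sum>z\<in>steps. v z) = 1 \<and> (\<forall>z\<in>steps. c \<le> v z)"

locale random_environment =
  fixes \<mu> :: "(int^'d::finite \<Rightarrow> real) measure" and c1 :: real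
  assumes prob: "prob_space \<mu>"
    and meas: "\<And>z. z \<in> (steps :: (int^'d) set) \<Longrightarrow> (\<lambda>v. v z) \<in> borel_measurable \<mu>"
    and c1_pos: "c1 > 0"
    and AE_good_row: "AE v in \<mu>. good_row c1 v"
begin

sublocale mu: prob_space \<mu> by (rule prob)
sublocale P: product_prob_space "\<lambda>_ :: int \<times> (int^'d). \<mu>" UNIV
  by (intro product_prob_spaceI prob)

abbreviation "PP \<equiv> PiM (UNIV :: (int \<times> (int^'d)) set) (\<lambda>_. \<mu>)"

lemma ex_good_row: "\<exists>v :: int^'d \<Rightarrow> real. good_row c1 v"
proof (rule ccontr)
  assume no: "\<not> ?thesis"
  have "AE v in \<mu>. False" using AE_good_row
    by (rule eventually_mono) (use no in blast)
  then show False by simp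
qed

definition v0 :: "int^'d \<Rightarrow> real" where "v0 = (SOME v. good_row c1 v)"

text \<open>Replacing the null set of rows that are not elliptic probability vectors makes all bounds below
  hold for every environment, not just almost surely.\<close>
definition clamp :: "(int^'d \<Rightarrow> real) \<Rightarrow> int^'d \<Rightarrow> real" where
  "clamp v = (if good_row c1 v then v else v0)"

lemma good_clamp: "good_row c1 (clamp v)"
  unfolding clamp_def v0_def using someI_ex[OF ex_good_row] by (metis (full_types))

lemma AE_clamp: "AE v in \<mu>. clamp v = v"
  using AE_good_row by eventually_elim (simp add: clamp_def)

lemma measurable_clamp [measurable]:
  assumes [simp]: "z \<in> steps" shows "(\<lambda>v. clamp v z) \<in> borel_measurable \<mu>"
proof -
  note meas[measurable]
  have [measurable]: "Measurable.pred \<mu> (good_row c1)"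
    unfolding good_row_def[abs_def] by measurable
  have "(\<lambda>v. clamp v z) = (\<lambda>v. if good_row c1 v then v z else v0 z)"
    by (auto simp: clamp_def)
  then show ?thesis by simp
qed

lemma clamp_ge: "z \<in> steps \<Longrightarrow> c1 \<le> clamp v z"
  using good_clamp[of v] by (simp add: good_row_def)

lemma clamp_pos: "z \<in> steps \<Longrightarrow> 0 < clamp v z"
  using clamp_ge c1_pos by (rule less_le_trans[rotated])

lemma sum_clamp: "(\<Sum>z\<in>steps. clamp v z) = 1"
  using good_clamp[of v] by (simp add: good_row_def)

lemma clamp_le_1: "z \<in> steps \<Longrightarrow> clamp v z \<le> 1"
  using member_le_sum[of z steps "clamp v"] clamp_pos sum_clamp less_imp_le by (metis Diff_iff finite_steps)

lemma abs_clamp_le_1: "z \<in> steps \<Longrightarrow> \<bar>clamp v z\<bar> \<le> 1"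
  using clamp_pos[of z v] clamp_le_1[of z v] by simp

lemma c1_le_1: "c1 \<le> 1"
  using clamp_ge[OF axis_in_steps(1)] clamp_le_1[OF axis_in_steps(1)] by (rule order_trans)

lemma integrable_clamp: "z \<in> steps \<Longrightarrow> integrable \<mu> (\<lambda>v. clamp v z)"
  by (rule mu.integrable_const_bound[where B = 1]) (use abs_clamp_le_1 in \<open>auto intro!: AE_I2\<close>)

lemma integrable_clamp2: "z \<in> steps \<Longrightarrow> w \<in> steps \<Longrightarrow> integrable \<mu> (\<lambda>v. clamp v z * clamp v w)"
  by (rule mu.integrable_const_bound[where B = 1])
     (use abs_clamp_le_1 in \<open>auto intro!: AE_I2 mult_le_one simp: abs_mult\<close>)

abbreviation "q \<equiv> q_avg \<mu>"

lemma q_eq: "z \<in> steps \<Longrightarrow> q z = (\<integral>v. clamp v z \<partial>\<mu>)"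
  unfolding q_avg_def by (rule integral_cong_AE) (use AE_clamp meas in \<open>auto elim: eventually_mono\<close>)

lemma q_ge: "z \<in> steps \<Longrightarrow> c1 \<le> q z"
  unfolding q_eq by (rule mu.integral_ge_const) (use clamp_ge integrable_clamp in auto)

lemma q_pos: "z \<in> steps \<Longrightarrow> 0 < q z"
  using q_ge c1_pos by (rule less_le_trans[rotated])

lemma sum_q: "sum q steps = 1"
proof -
  have "sum q steps = (\<integral>v. (\<Sum>z\<in>steps. clamp v z) \<partial>\<mu>)"
    using integrable_clamp by (subst Bochner_Integration.integral_sum) (auto simp: q_eq)
  then show ?thesis by (simp add: sum_clamp mu.prob_space)
qed

text \<open>The joint step law of two walkers who stand at the same site at the same time and so
  share a row. Its deviation from \<open>q z * q w\<close> is the whole interaction.\<close>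

definition r :: "int^'d \<Rightarrow> int^'d \<Rightarrow> real" where
  "r z w = (\<integral>v. clamp v z * clamp v w \<partial>\<mu>)"

lemma r_pos: assumes "z \<in> steps" "w \<in> steps" shows "0 < r z w"
proof -
  have "0 < c1 * c1" using c1_pos by simp
  also have "c1 * c1 \<le> r z w"
    unfolding r_def using clamp_ge clamp_pos c1_pos assms integrable_clamp2
    by (intro mu.integral_ge_const AE_I2 mult_mono) (auto intro: less_imp_le)
  finally show ?thesis .
qed

lemma sum_r: "(\<Sum>z\<in>steps. \<Sum>w\<in>steps. r z w) = 1"
proof -
  have "(\<Sum>z\<in>steps. \<Sum>w\<in>steps. r z w) = (\<integral>v. (\<Sum>z\<in>steps. \<Sum>w\<in>steps. clamp v z * clamp v w) \<partial>\<mu>)"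
    using integrable_clamp2
    by (simp add: r_def Bochner_Integration.integral_sum Bochner_Integration.integrable_sum)
  also have "(\<lambda>v. \<Sum>z\<in>steps. \<Sum>w\<in>steps. clamp v z * clamp v w) = (\<lambda>v. 1)"
    by (simp add: sum_clamp flip: sum_product)
  finally show ?thesis by (simp add: mu.prob_space)
qed

definition cl :: "'d env \<Rightarrow> 'd env" where
  "cl \<omega> = (\<lambda>p. clamp (\<omega> p))"

lemma AE_cl: "AE \<omega> in PP. cl \<omega> = \<omega>"
proof -
  have "AE \<omega> in PP. \<forall>p. clamp (\<omega> p) = \<omega> p"
    unfolding AE_all_countable by (intro allI AE_PiM_component prob AE_clamp) auto
  then show ?thesis by eventually_elim (auto simp: cl_def fun_eq_iff)
qed

lemma measurable_clamp_coord:
  "p \<in> I \<Longrightarrow> z \<in> steps \<Longrightarrow> (\<lambda>\<omega>. clamp (\<omega> p) z) \<in> borel_measurable (PiM I (\<lambda>_. \<mu>))"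
  using measurable_compose[OF measurable_component_singleton[of p I "\<lambda>_. \<mu>"] measurable_clamp] by simp

lemma measurable_cl [measurable]:
  "z \<in> steps \<Longrightarrow> (\<lambda>\<omega>. cl \<omega> p z) \<in> borel_measurable PP"
  unfolding cl_def by (rule measurable_clamp_coord) auto

lemma path_prob_bounds:
  assumes "s \<in> paths n"
  shows "c1 ^ n \<le> path_prob (cl \<omega>) k x s" "0 < path_prob (cl \<omega>) k x s" "path_prob (cl \<omega>) k x s \<le> 1"
proof -
  have "(\<Prod>j<n. c1) \<le> (\<Prod>j<n. cl \<omega> (k + int j, x + sum_list (take j s)) (s ! j))"
    using c1_pos clamp_ge nth_paths[OF assms] by (intro prod_mono) (auto simp: cl_def)
  then show *: "c1 ^ n \<le> path_prob (cl \<omega>) k x s"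
    by (simp add: path_prob_def length_paths[OF assms])
  show "0 < path_prob (cl \<omega>) k x s"
    using * c1_pos by (meson less_le_trans zero_less_power)
  show "path_prob (cl \<omega>) k x s \<le> 1"
    using clamp_le_1 order.strict_implies_order[OF clamp_pos] nth_paths[OF assms]
    by (auto simp: path_prob_def length_paths[OF assms] cl_def intro!: prod_le_1)
qed

lemma measurable_path_prob [measurable]:
  "s \<in> paths n \<Longrightarrow> (\<lambda>\<omega>. path_prob (cl \<omega>) k x s) \<in> borel_measurable PP"
  unfolding path_prob_def by (intro borel_measurable_prod measurable_cl) (auto simp: paths_def)

section \<open>Independence of the time layers and averages over paths\<close>

lemma indep_coords: "P.indep_vars (\<lambda>_. \<mu>) (\<lambda>i \<omega>. \<omega> i) UNIV"
proof (subst P.indep_vars_iff_distr_eq_PiM)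
  have "distr PP PP (\<lambda>\<omega>. restrict (\<lambda>i. \<omega> i) UNIV) = distr PP PP (\<lambda>\<omega>. \<omega>)"
    by (rule distr_cong) auto
  then show "distr PP PP (\<lambda>\<omega>. restrict (\<lambda>i. \<omega> i) UNIV) = (\<Pi>\<^sub>M i\<in>UNIV. distr PP \<mu> (\<lambda>\<omega>. \<omega> i))"
    by (simp add: distr_id2 P.PiM_component)
qed auto

text \<open>Time advances by one per step, so a path reads one row from each layer. Grouping rows by
  time keeps this usable for pairs of paths, which can share a row only within one layer.\<close>

definition layer :: "int \<Rightarrow> (int \<times> (int^'d)) set" where
  "layer k = {k} \<times> UNIV"

lemma indep_layers:
  "P.indep_vars (\<lambda>j::nat. PiM (layer (k + int j)) (\<lambda>_. \<mu>)) (\<lambda>j \<omega>. restrict \<omega> (layer (k + int j))) J"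
  by (rule P.indep_vars_restrict[OF indep_coords]) (auto simp: disjoint_family_on_def layer_def)

lemma expectation_prod_layers:
  fixes \<Phi> :: "nat \<Rightarrow> 'd env \<Rightarrow> real"
  assumes meas: "\<And>j. j < n \<Longrightarrow> \<Phi> j \<in> borel_measurable (PiM (layer (k + int j)) (\<lambda>_. \<mu>))"
    and bnd: "\<And>j \<omega>. j < n \<Longrightarrow> \<bar>\<Phi> j \<omega>\<bar> \<le> 1"
  shows "(\<integral>\<omega>. (\<Prod>j<n. \<Phi> j (restrict \<omega> (layer (k + int j)))) \<partial>PP) = (\<Prod>j<n. \<integral>\<omega>. \<Phi> j (restrict \<omega> (layer (k + int j))) \<partial>PP)"
proof (rule P.indep_vars_lebesgue_integral)
  have *: "P.indep_vars (\<lambda>_. borel) (\<lambda>j \<omega>. \<Phi> j (restrict \<omega> (layer (k + int j)))) {..<n}"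
    by (rule P.indep_vars_compose2[OF indep_layers]) (use meas in auto)
  then show "P.indep_vars (\<lambda>_. borel) (\<lambda>j \<omega>. \<Phi> j (restrict \<omega> (layer (k + int j)))) {..<n}" .
  show "integrable PP (\<lambda>\<omega>. \<Phi> j (restrict \<omega> (layer (k + int j))))" if "j \<in> {..<n}" for j
    by (rule P.integrable_const_bound[where B = 1]) (use * bnd that in \<open>auto simp: P.indep_vars_def intro!: AE_I2\<close>)
qed auto

lemma expectation_coord:
  fixes f :: "(int^'d \<Rightarrow> real) \<Rightarrow> real"
  assumes "f \<in> borel_measurable \<mu>"
  shows "(\<integral>\<omega>. f (\<omega> p) \<partial>PP) = integral\<^sup>L \<mu> f"
proof -
  have "integral\<^sup>L (distr PP \<mu> (\<lambda>\<omega>. \<omega> p)) f = (\<integral>\<omega>. f (\<omega> p) \<partial>PP)"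
    using measurable_component_singleton[of p UNIV "\<lambda>_. \<mu>"] assms by (intro integral_distr) auto
  then show ?thesis by (simp add: P.PiM_component)
qed

text \<open>Rows at distinct sites are independent, so only displacement 0 feels the correlation;
  rows are identically distributed, so the displacement is all that matters.\<close>

definition pair_kernel :: "int^'d \<Rightarrow> int^'d \<Rightarrow> int^'d \<Rightarrow> real" where
  "pair_kernel x z w = (if x = 0 then r z w else q z * q w)"

lemma expectation_pair:
  assumes zw: "z \<in> steps" "w \<in> steps"
  shows "(\<integral>\<omega>. cl \<omega> (k,x) z * cl \<omega> (k,y) w \<partial>PP) = pair_kernel (x - y) z w"
proof (cases "x = y")
  case True
  then show ?thesis
    using expectation_coord[of "\<lambda>v. clamp v z * clamp v w" "(k,y)"] zw
    by (simp add: pair_kernel_def r_def cl_def)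
next
  case False
  let ?p = "(k,x)" and ?p' = "(k,y)"
  \<comment> \<open>One family indexed by sites encodes both factors, so that independence applies
    as a product over a two-element set.\<close>
  let ?Y = "\<lambda>i v. clamp v (if i = ?p then z else w)"
  have "(\<integral>\<omega>. (\<Prod>i\<in>{?p,?p'}. ?Y i (\<omega> i)) \<partial>PP) = (\<Prod>i\<in>{?p,?p'}. \<integral>\<omega>. ?Y i (\<omega> i) \<partial>PP)"
  proof (rule P.indep_vars_lebesgue_integral)
    have *: "P.indep_vars (\<lambda>_. borel) (\<lambda>i \<omega>. ?Y i (\<omega> i)) {?p,?p'}"
      by (rule P.indep_vars_compose2[OF P.indep_vars_subset[OF indep_coords]]) (use zw in auto)
    then show "P.indep_vars (\<lambda>_. borel) (\<lambda>i \<omega>. ?Y i (\<omega> i)) {?p,?p'}" .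
    show "integrable PP (\<lambda>\<omega>. ?Y i (\<omega> i))" if "i \<in> {?p,?p'}" for i
      by (rule P.integrable_const_bound[where B = 1])
        (use * that zw abs_clamp_le_1 in \<open>auto simp: P.indep_vars_def intro!: AE_I2\<close>)
  qed auto
  then show ?thesis using False zw
    by (simp add: cl_def pair_kernel_def q_eq expectation_coord[OF measurable_clamp])
qed

lemma expectation_path:
  assumes s: "s \<in> paths n"
  shows "(\<integral>\<omega>. path_prob (cl \<omega>) k x s \<partial>PP) = (\<Prod>j<n. q (s ! j))"
proof -
  define p where "p = (\<lambda>j. (k + int j, x + sum_list (take j s)))"
  define \<Phi> where "\<Phi> = (\<lambda>j (\<omega> :: 'd env). clamp (\<omega> (p j)) (s ! j))"
  have p: "p j \<in> layer (k + int j)" for j by (simp add: p_def layer_def)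
  have \<Phi>: "\<Phi> j (restrict \<omega> (layer (k + int j))) = cl \<omega> (p j) (s ! j)" for j \<omega>
    using p by (simp add: \<Phi>_def cl_def)
  have "(\<integral>\<omega>. path_prob (cl \<omega>) k x s \<partial>PP) = (\<integral>\<omega>. (\<Prod>j<n. \<Phi> j (restrict \<omega> (layer (k + int j)))) \<partial>PP)"
    unfolding path_prob_def \<Phi> length_paths[OF s] by (simp add: p_def)
  also have "\<dots> = (\<Prod>j<n. \<integral>\<omega>. \<Phi> j (restrict \<omega> (layer (k + int j))) \<partial>PP)"
  proof (rule expectation_prod_layers)
    show "\<Phi> j \<in> borel_measurable (PiM (layer (k + int j)) (\<lambda>_. \<mu>))" if "j < n" for j
      unfolding \<Phi>_def
      by (rule measurable_clamp_coord[OF p nth_paths[OF s that]])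
    show "\<bar>\<Phi> j \<omega>\<bar> \<le> 1" if "j < n" for j \<omega>
      using nth_paths[OF s that] abs_clamp_le_1 by (auto simp: \<Phi>_def)
  qed
  also have "\<dots> = (\<Prod>j<n. q (s ! j))"
  proof (rule prod.cong)
    fix j assume "j \<in> {..<n}"
    then have st: "s ! j \<in> steps" using nth_paths[OF s] by auto
    show "(\<integral>\<omega>. \<Phi> j (restrict \<omega> (layer (k + int j))) \<partial>PP) = q (s ! j)"
      unfolding \<Phi> cl_def using expectation_coord[OF measurable_clamp[OF st], of "p j"] q_eq[OF st] by simp
  qed simp
  finally show ?thesis .
qed

text \<open>At each time both paths read the same layer, so the expectation factorises over time and
  each layer contributes the kernel at the current displacement. The common start drops out.\<close>

lemma expectation_path_pair:
  assumes s: "s \<in> paths n" and t: "t \<in> paths n"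
  shows "(\<integral>\<omega>. path_prob (cl \<omega>) k x s * path_prob (cl \<omega>) k x t \<partial>PP)
    = (\<Prod>j<n. pair_kernel (sum_list (take j s) - sum_list (take j t)) (s ! j) (t ! j))"
proof -
  define p where "p = (\<lambda>j s. (k + int j, x + sum_list (take j s)))"
  define \<Phi> where "\<Phi> = (\<lambda>j (\<omega> :: 'd env). clamp (\<omega> (p j s)) (s ! j) * clamp (\<omega> (p j t)) (t ! j))"
  have p: "p j u \<in> layer (k + int j)" for j u by (simp add: p_def layer_def)
  have \<Phi>: "\<Phi> j (restrict \<omega> (layer (k + int j))) = cl \<omega> (p j s) (s ! j) * cl \<omega> (p j t) (t ! j)" for j \<omega>
    using p by (simp add: \<Phi>_def cl_def)
  have "(\<integral>\<omega>. path_prob (cl \<omega>) k x s * path_prob (cl \<omega>) k x t \<partial>PP)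
      = (\<integral>\<omega>. (\<Prod>j<n. \<Phi> j (restrict \<omega> (layer (k + int j)))) \<partial>PP)"
    unfolding path_prob_def \<Phi> length_paths[OF s] length_paths[OF t] prod.distrib by (simp add: p_def)
  also have "\<dots> = (\<Prod>j<n. \<integral>\<omega>. \<Phi> j (restrict \<omega> (layer (k + int j))) \<partial>PP)"
  proof (rule expectation_prod_layers)
    show "\<Phi> j \<in> borel_measurable (PiM (layer (k + int j)) (\<lambda>_. \<mu>))" if "j < n" for j
      unfolding \<Phi>_def
      by (intro borel_measurable_times measurable_clamp_coord p nth_paths[OF s that] nth_paths[OF t that])
    show "\<bar>\<Phi> j \<omega>\<bar> \<le> 1" if "j < n" for j \<omega>
      using nth_paths[OF s that] nth_paths[OF t that] abs_clamp_le_1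
      by (auto simp: \<Phi>_def abs_mult intro!: mult_le_one)
  qed
  also have "\<dots> = (\<Prod>j<n. pair_kernel (sum_list (take j s) - sum_list (take j t)) (s ! j) (t ! j))"
  proof (rule prod.cong)
    fix j assume "j \<in> {..<n}"
    then have st: "s ! j \<in> steps" "t ! j \<in> steps" using nth_paths[OF s] nth_paths[OF t] by auto
    show "(\<integral>\<omega>. \<Phi> j (restrict \<omega> (layer (k + int j))) \<partial>PP) =
        pair_kernel (sum_list (take j s) - sum_list (take j t)) (s ! j) (t ! j)"
      unfolding \<Phi> p_def using expectation_pair[OF st] by simp
  qed simp
  finally show ?thesis .
qed

section \<open>Exponential tilting and the second moment\<close>

lemma prob_PP: "P.prob (space PP) = 1"
  by (rule prob_space.prob_space, rule prob_space_PiM, rule prob)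

abbreviation "\<Lambda> \<equiv> Lambda_c \<mu>"

definition tilt :: "real^'d \<Rightarrow> int^'d \<Rightarrow> real" where
  "tilt \<theta> z = exp (\<theta> \<bullet> to_real_vec z - \<Lambda> \<theta>)"

definition mgf :: "real^'d \<Rightarrow> real" where
  "mgf \<theta> = (\<Sum>z\<in>steps. q z * exp (\<theta> \<bullet> to_real_vec z))"

text \<open>The gradient of \<open>\<Lambda>\<close> at \<open>\<theta>\<close>, written as the mean
  of the tilted step law.\<close>

definition xi :: "real^'d \<Rightarrow> real^'d" where
  "xi \<theta> = (\<Sum>z\<in>steps. (q z * tilt \<theta> z) *\<^sub>R to_real_vec z)"

lemma mgf_pos: "mgf \<theta> > 0"
  unfolding mgf_def by (intro sum_pos) (auto simp: q_pos)

lemma exp_Lambda: "exp (\<Lambda> \<theta>) = mgf \<theta>"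
  using mgf_pos[of \<theta>] by (simp add: Lambda_c_def mgf_def)

lemma sum_q_tilt: "(\<Sum>z\<in>steps. q z * tilt \<theta> z) = 1"
proof -
  have "(\<Sum>z\<in>steps. q z * tilt \<theta> z) = mgf \<theta> / exp (\<Lambda> \<theta>)"
    by (simp add: tilt_def mgf_def exp_diff sum_divide_distrib)
  then show ?thesis by (simp add: exp_Lambda mgf_pos less_imp_neq[symmetric])
qed

lemma tilt_pos: "tilt \<theta> z > 0" by (simp add: tilt_def)

lemma abs_inner_step_le: "z \<in> steps \<Longrightarrow> \<bar>\<theta> \<bullet> to_real_vec z\<bar> \<le> norm \<theta>"
  using Cauchy_Schwarz_ineq2[of \<theta> "to_real_vec z"] mult_left_mono[OF norm_to_real_vec_step, of z "norm \<theta>"]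
  by simp

lemma abs_Lambda_le: "\<bar>\<Lambda> \<theta>\<bar> \<le> norm \<theta>"
proof -
  have "mgf \<theta> \<le> (\<Sum>z\<in>steps. q z * exp (norm \<theta>))"
    unfolding mgf_def using abs_inner_step_le by (intro sum_mono mult_left_mono) (auto simp: abs_le_iff q_pos less_imp_le)
  then have "mgf \<theta> \<le> exp (norm \<theta>)" by (simp add: sum_q flip: sum_distrib_right)
  moreover have "(\<Sum>z\<in>steps. q z * exp (- norm \<theta>)) \<le> mgf \<theta>"
    unfolding mgf_def
  proof (intro sum_mono mult_left_mono)
    fix z :: "int^'d" assume "z \<in> steps"
    then show "exp (- norm \<theta>) \<le> exp (\<theta> \<bullet> to_real_vec z)" "0 \<le> q z"
      using abs_inner_step_le[of z \<theta>] q_pos[of z] by auto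
  qed
  then have "exp (- norm \<theta>) \<le> mgf \<theta>" by (simp add: sum_q flip: sum_distrib_right)
  ultimately show ?thesis by (simp flip: exp_Lambda)
qed

lemma tilt_bounds:
  assumes "z \<in> steps" "norm \<theta> \<le> \<delta>"
  shows "exp (- (2 * \<delta>)) \<le> tilt \<theta> z" "tilt \<theta> z \<le> exp (2 * \<delta>)"
  using abs_inner_step_le[OF assms(1), of \<theta>] abs_Lambda_le[of \<theta>] assms(2) by (auto simp: tilt_def)

lemma pair_tilt_bounds:
  assumes "z \<in> steps" "w \<in> steps" "norm \<theta> \<le> \<delta>"
  shows "exp (- (4 * \<delta>)) \<le> tilt \<theta> z * tilt \<theta> w" "tilt \<theta> z * tilt \<theta> w \<le> exp (4 * \<delta>)"
proof -
  have "exp (- (2 * \<delta>)) * exp (- (2 * \<delta>)) \<le> tilt \<theta> z * tilt \<theta> w"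
    using assms tilt_bounds tilt_pos by (intro mult_mono) (auto intro: less_imp_le)
  then show "exp (- (4 * \<delta>)) \<le> tilt \<theta> z * tilt \<theta> w" by (simp flip: exp_add)
  have "tilt \<theta> z * tilt \<theta> w \<le> exp (2 * \<delta>) * exp (2 * \<delta>)"
    using assms tilt_bounds tilt_pos by (intro mult_mono) (auto intro: less_imp_le)
  then show "tilt \<theta> z * tilt \<theta> w \<le> exp (4 * \<delta>)" by (simp flip: exp_add)
qed

lemma pair_kernel_nonneg: "z \<in> steps \<Longrightarrow> w \<in> steps \<Longrightarrow> pair_kernel x z w \<ge> 0"
  using r_pos[of z w] q_pos[of z] q_pos[of w] by (auto simp: pair_kernel_def)

text \<open>Take \<open>h = 1 + g\<close>. Away from the origin the tilted kernel is a symmetric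
  probability close to \<open>q z * q w\<close>, so it preserves 1 and does not increase
  \<open>g\<close>. At the origin its mass can exceed 1, but by a factor at most
  \<open>exp (4 * \<delta>)\<close>, and the strict gap \<open>G < g 0\<close> pays for it.
  \<open>G\<close> involves no tilt, so one \<open>\<delta>\<close> works for all
  \<open>\<theta>\<close>.\<close>

lemma tilted_pair_superharmonic:
  assumes d3: "CARD('d) \<ge> 3"
  obtains \<delta> :: real and h :: "int^'d \<Rightarrow> real" where "\<delta> > 0" "\<And>x. h x \<ge> 1"
    "\<And>\<theta> x. norm \<theta> \<le> \<delta> \<Longrightarrow>
      (\<Sum>z\<in>steps. \<Sum>w\<in>steps. pair_kernel x z w * (tilt \<theta> z * tilt \<theta> w) * h (x + z - w)) \<le> h x"
proof (rule lyapunov_function[OF d3 q_pos sum_q])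
  fix g :: "real^'d \<Rightarrow> real"
  assume gpos: "\<And>x. g x > 0" and g0: "\<And>x. x \<noteq> 0 \<Longrightarrow> g x < g 0"
    and g: "\<And>p x. \<lbrakk>\<And>z w. z \<in> steps \<Longrightarrow> w \<in> steps \<Longrightarrow> p z w = p w z;
      \<And>z w. z \<in> steps \<Longrightarrow> w \<in> steps \<Longrightarrow> q z * q w / 1.04 \<le> p z w \<and> p z w \<le> 1.04 * (q z * q w);
      (\<Sum>z\<in>steps. \<Sum>w\<in>steps. p z w) = 1\<rbrakk>
      \<Longrightarrow> (\<Sum>z\<in>steps. \<Sum>w\<in>steps. p z w * g (x + to_real_vec z - to_real_vec w)) \<le> g x"
  have gle: "g x \<le> g 0" for x using g0[of x] by (cases "x = 0") auto
  define G where "G = (\<Sum>z\<in>steps. \<Sum>w\<in>steps. r z w * g (to_real_vec z - to_real_vec w))"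
  have G0: "G \<ge> 0"
    unfolding G_def using r_pos gpos by (auto intro!: sum_nonneg mult_nonneg_nonneg intro: less_imp_le)
  \<comment> \<open>By ellipticity the walkers separate along opposite steps with positive
    probability, and \<open>g\<close> is strictly smaller off the origin.\<close>
  have "G < g 0"
  proof -
    fix i :: 'd
    let ?e = "axis i 1 :: int^'d" and ?f = "axis i (-1) :: int^'d"
    have ef: "to_real_vec ?e - to_real_vec ?f \<noteq> 0"
    proof
      assume "to_real_vec ?e - to_real_vec ?f = 0"
      then have "(to_real_vec ?e - to_real_vec ?f) $ i = 0" by simp
      then show False by (simp del: to_real_vec_axis add: to_real_vec_def)
    qed
    have le: "r z w * g (to_real_vec z - to_real_vec w) \<le> r z w * g 0" if "z \<in> steps" "w \<in> steps" for z w
      using r_pos[OF that] gle by simp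
    have "G < (\<Sum>z\<in>steps. \<Sum>w\<in>steps. r z w * g 0)"
      unfolding G_def
    proof (rule sum_strict_mono_ex1)
      show "\<forall>z\<in>steps. (\<Sum>w\<in>steps. r z w * g (to_real_vec z - to_real_vec w)) \<le> (\<Sum>w\<in>steps. r z w * g 0)"
        using le by (auto intro!: sum_mono)
      have "(\<Sum>w\<in>steps. r ?e w * g (to_real_vec ?e - to_real_vec w)) < (\<Sum>w\<in>steps. r ?e w * g 0)"
      proof (rule sum_strict_mono_ex1)
        show "\<forall>w\<in>steps. r ?e w * g (to_real_vec ?e - to_real_vec w) \<le> r ?e w * g 0"
          using le axis_in_steps by blast
        show "\<exists>w\<in>steps. r ?e w * g (to_real_vec ?e - to_real_vec w) < r ?e w * g 0"
          using r_pos[OF axis_in_steps, of i i] g0[OF ef] axis_in_steps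
          by (intro bexI[of _ ?f] mult_strict_left_mono) auto
      qed simp
      then show "\<exists>z\<in>steps. (\<Sum>w\<in>steps. r z w * g (to_real_vec z - to_real_vec w)) < (\<Sum>w\<in>steps. r z w * g 0)"
        using axis_in_steps by blast
    qed simp
    also have "\<dots> = g 0" using sum_r by (simp flip: sum_distrib_right)
    finally show ?thesis .
  qed
  \<comment> \<open>Each walker's tilt costs at most \<open>exp (2 * \<delta>)\<close>, one
    \<open>\<delta>\<close> from the linear term and one from \<open>\<Lambda>\<close>; hence the 4.
    The two logarithms serve the displacements off and at the origin.\<close>
  define \<delta> where "\<delta> = min (ln 1.04) (ln ((1 + g 0) / (1 + G))) / 4"
  have frac: "(1 + g 0) / (1 + G) > 1" using \<open>G < g 0\<close> G0 by (simp add: field_simps)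
  have \<delta>: "\<delta> > 0" using frac by (simp add: \<delta>_def)
  have e1: "exp (4 * \<delta>) \<le> 1.04"
  proof -
    have "4 * \<delta> \<le> ln 1.04" by (simp add: \<delta>_def)
    then have "exp (4 * \<delta>) \<le> exp (ln 1.04)" by (simp only: exp_le_cancel_iff)
    also have "\<dots> = 1.04" by (rule exp_ln) simp
    finally show ?thesis .
  qed
  have e2: "exp (4 * \<delta>) \<le> (1 + g 0) / (1 + G)"
  proof -
    have "4 * \<delta> \<le> ln ((1 + g 0) / (1 + G))" by (simp add: \<delta>_def)
    then have "exp (4 * \<delta>) \<le> exp (ln ((1 + g 0) / (1 + G)))" by (simp only: exp_le_cancel_iff)
    also have "\<dots> = (1 + g 0) / (1 + G)" by (rule exp_ln) (use frac in linarith)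
    finally show ?thesis .
  qed
  have e3: "1 / 1.04 \<le> exp (- (4 * \<delta>))"
    using e1 by (simp add: exp_minus field_simps)
  define h where "h = (\<lambda>x. 1 + g (to_real_vec x))"
  show thesis
  proof (rule that[of \<delta> h])
    show "h x \<ge> 1" for x using gpos[of "to_real_vec x"] by (simp add: h_def)
    fix \<theta> :: "real^'d" and x :: "int^'d"
    assume \<theta>: "norm \<theta> \<le> \<delta>"
    show "(\<Sum>z\<in>steps. \<Sum>w\<in>steps. pair_kernel x z w * (tilt \<theta> z * tilt \<theta> w) * h (x + z - w)) \<le> h x"
    proof (cases "x = 0")
      case True
      have "(\<Sum>z\<in>steps. \<Sum>w\<in>steps. pair_kernel x z w * (tilt \<theta> z * tilt \<theta> w) * h (x + z - w))
        \<le> (\<Sum>z\<in>steps. \<Sum>w\<in>steps. exp (4 * \<delta>) * (r z w * h (z - w)))"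
      proof (intro sum_mono)
        fix z w :: "int^'d" assume zw: "z \<in> steps" "w \<in> steps"
        have "0 \<le> r z w * h (z - w)" using r_pos[OF zw] gpos[of "to_real_vec (z - w)"] by (simp add: h_def)
        from mult_right_mono[OF pair_tilt_bounds(2)[OF zw \<theta>] this]
        show "pair_kernel x z w * (tilt \<theta> z * tilt \<theta> w) * h (x + z - w) \<le> exp (4 * \<delta>) * (r z w * h (z - w))"
          by (simp add: True pair_kernel_def mult_ac)
      qed
      also have "\<dots> = exp (4 * \<delta>) * (1 + G)"
        by (simp add: h_def G_def distrib_left sum.distrib sum_r flip: sum_distrib_left)
      also have "\<dots> \<le> 1 + g 0" using e2 G0 by (simp add: field_simps)
      finally show ?thesis by (simp add: True h_def)
    next
      case False
      define p where "p = (\<lambda>z w. q z * q w * (tilt \<theta> z * tilt \<theta> w))"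
      have p1: "(\<Sum>z\<in>steps. \<Sum>w\<in>steps. p z w) = 1"
      proof -
        have "(\<Sum>z\<in>steps. \<Sum>w\<in>steps. p z w) = (\<Sum>z\<in>steps. q z * tilt \<theta> z) * (\<Sum>z\<in>steps. q z * tilt \<theta> z)"
          by (simp add: p_def sum_product mult_ac)
        then show ?thesis by (simp add: sum_q_tilt)
      qed
      have "(\<Sum>z\<in>steps. \<Sum>w\<in>steps. p z w * g (to_real_vec x + to_real_vec z - to_real_vec w)) \<le> g (to_real_vec x)"
      proof (rule g[OF _ _ p1])
        fix z w :: "int^'d" assume zw: "z \<in> steps" "w \<in> steps"
        show "p z w = p w z" by (simp add: p_def mult_ac)
        have qq: "0 \<le> q z * q w" using q_pos zw by (simp add: less_imp_le)
        have b: "1 / 1.04 \<le> tilt \<theta> z * tilt \<theta> w" "tilt \<theta> z * tilt \<theta> w \<le> 1.04"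
          using pair_tilt_bounds[OF zw \<theta>] e1 e3 by linarith+
        show "q z * q w / 1.04 \<le> p z w \<and> p z w \<le> 1.04 * (q z * q w)"
          using mult_left_mono[OF b(1) qq] mult_left_mono[OF b(2) qq] by (simp add: p_def mult_ac)
      qed
      then show ?thesis
        using False p1 by (simp add: h_def pair_kernel_def p_def distrib_left sum.distrib)
    qed
  qed (rule \<delta>)
qed

section \<open>Tilted partition functions and their first two moments\<close>

definition weight :: "real^'d \<Rightarrow> nat \<Rightarrow> (int^'d) list \<Rightarrow> real" where
  "weight \<theta> n s = exp (\<theta> \<bullet> to_real_vec (sum_list s) - real n * \<Lambda> \<theta>)"

lemma weight_pos: "weight \<theta> n s > 0" by (simp add: weight_def)

text \<open>The defining form sees only the endpoint and is used for estimates near a given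
  velocity; the product form is what expectations over independent layers need.\<close>

lemma weight_eq_prod: "length s = n \<Longrightarrow> weight \<theta> n s = (\<Prod>j<n. tilt \<theta> (s ! j))"
proof (induction s arbitrary: n)
  case Nil
  then show ?case by (simp add: weight_def)
next
  case (Cons z s)
  then obtain m where m: "n = Suc m" "length s = m" by (cases n) auto
  have "weight \<theta> n (z # s) = tilt \<theta> z * weight \<theta> m s"
    by (simp add: weight_def tilt_def m inner_add_right algebra_simps flip: exp_add)
  also have "weight \<theta> m s = (\<Prod>j<m. tilt \<theta> (s ! j))" by (rule Cons.IH[OF m(2)])
  finally show ?case by (simp add: m prod.lessThan_Suc_shift del: prod.lessThan_Suc)
qed

definition Z :: "real^'d \<Rightarrow> nat \<Rightarrow> (int^'d) list set \<Rightarrow> 'd env \<Rightarrow> real" where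
  "Z \<theta> n Q \<omega> = (\<Sum>s\<in>Q. weight \<theta> n s * path_prob (cl \<omega>) 0 0 s)"

lemma measurable_Z [measurable]: "Q \<subseteq> paths n \<Longrightarrow> Z \<theta> n Q \<in> borel_measurable PP"
  unfolding Z_def[abs_def] by (intro borel_measurable_sum borel_measurable_times measurable_path_prob) auto

lemma Z_mono: "Q \<subseteq> paths n \<Longrightarrow> 0 \<le> Z \<theta> n Q \<omega>" "Q \<subseteq> paths n \<Longrightarrow> Z \<theta> n Q \<omega> \<le> Z \<theta> n (paths n) \<omega>"
  unfolding Z_def using less_imp_le[OF weight_pos] less_imp_le[OF path_prob_bounds(2)]
  by (auto intro!: sum_nonneg sum_mono2 mult_nonneg_nonneg)

lemma integrable_path_prob: "s \<in> paths n \<Longrightarrow> integrable PP (\<lambda>\<omega>. path_prob (cl \<omega>) k x s)"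
  by (rule P.integrable_const_bound[where B = 1])
    (use path_prob_bounds in \<open>auto intro!: AE_I2 measurable_path_prob simp: abs_of_pos\<close>)

lemma integrable_path_prob2:
  "s \<in> paths n \<Longrightarrow> t \<in> paths n \<Longrightarrow> integrable PP (\<lambda>\<omega>. path_prob (cl \<omega>) k x s * path_prob (cl \<omega>) k x t)"
  by (rule P.integrable_const_bound[where B = 1])
    (use path_prob_bounds in \<open>auto intro!: AE_I2 mult_le_one borel_measurable_times measurable_path_prob
      simp: abs_mult abs_of_pos intro: less_imp_le\<close>)

lemma integrable_Z: "Q \<subseteq> paths n \<Longrightarrow> integrable PP (Z \<theta> n Q)"
  unfolding Z_def[abs_def]
  by (intro Bochner_Integration.integrable_sum integrable_mult_right integrable_path_prob) auto

lemma Z_square: "(Z \<theta> n Q \<omega>)\<^sup>2 = (\<Sum>s\<in>Q. \<Sum>t\<in>Q. weight \<theta> n s * weight \<theta> n t *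
    (path_prob (cl \<omega>) 0 0 s * path_prob (cl \<omega>) 0 0 t))"
  by (simp add: Z_def power2_eq_square sum_product mult_ac)

lemma integrable_Z_square: "Q \<subseteq> paths n \<Longrightarrow> integrable PP (\<lambda>\<omega>. (Z \<theta> n Q \<omega>)\<^sup>2)"
  unfolding Z_square
  by (intro Bochner_Integration.integrable_sum integrable_mult_right integrable_path_prob2) auto

lemma expectation_Z:
  assumes "Q \<subseteq> paths n"
  shows "P.expectation (Z \<theta> n Q) = (\<Sum>s\<in>Q. \<Prod>j<n. q (s ! j) * tilt \<theta> (s ! j))"
proof -
  have "P.expectation (Z \<theta> n Q) = (\<Sum>s\<in>Q. weight \<theta> n s * P.expectation (\<lambda>\<omega>. path_prob (cl \<omega>) 0 0 s))"
    unfolding Z_def[abs_def] using assms integrable_path_prob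
    by (subst Bochner_Integration.integral_sum) auto
  also have "\<dots> = (\<Sum>s\<in>Q. \<Prod>j<n. q (s ! j) * tilt \<theta> (s ! j))"
    using assms by (intro sum.cong refl)
      (auto simp: expectation_path weight_eq_prod length_paths prod.distrib subset_iff)
  finally show ?thesis .
qed

text \<open>Dropping the restriction to \<open>Q\<close> only enlarges the nonnegative sum, and the
  full second moment is the mass of tilted pairs started at displacement 0.\<close>

lemma expectation_Z_square_le:
  assumes h: "\<And>x. h x \<ge> 1" and Q: "Q \<subseteq> paths n"
    and sup: "\<And>x. (\<Sum>z\<in>steps. \<Sum>w\<in>steps. pair_kernel x z w * (tilt \<theta> z * tilt \<theta> w) * h (x + z - w)) \<le> h x"
  shows "P.expectation (\<lambda>\<omega>. (Z \<theta> n Q \<omega>)\<^sup>2) \<le> h 0"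
proof -
  have "P.expectation (\<lambda>\<omega>. (Z \<theta> n Q \<omega>)\<^sup>2) \<le> P.expectation (\<lambda>\<omega>. (Z \<theta> n (paths n) \<omega>)\<^sup>2)"
    using Q Z_mono[OF Q] by (intro integral_mono integrable_Z_square power_mono) auto
  also have "\<dots> = (\<Sum>s\<in>paths n. \<Sum>t\<in>paths n. weight \<theta> n s * weight \<theta> n t *
      P.expectation (\<lambda>\<omega>. path_prob (cl \<omega>) 0 0 s * path_prob (cl \<omega>) 0 0 t))"
    unfolding Z_square using integrable_path_prob2
    by (subst Bochner_Integration.integral_sum; (intro Bochner_Integration.integrable_sum)?)
       (auto simp: Bochner_Integration.integral_sum intro!: sum.cong)
  also have "\<dots> = (\<Sum>s\<in>paths n. \<Sum>t\<in>paths n. \<Prod>j<n.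
      pair_kernel (0 + sum_list (take j s) - sum_list (take j t)) (s ! j) (t ! j) * (tilt \<theta> (s ! j) * tilt \<theta> (t ! j)))"
    by (intro sum.cong refl) (simp add: expectation_path_pair weight_eq_prod length_paths prod.distrib mult_ac)
  also have "\<dots> \<le> h 0"
    by (rule pair_weight_le[where k = "\<lambda>x z w. pair_kernel x z w * (tilt \<theta> z * tilt \<theta> w)"])
       (use h sup pair_kernel_nonneg tilt_pos in \<open>auto intro!: mult_nonneg_nonneg intro: less_imp_le\<close>)
  finally show ?thesis .
qed

definition near :: "real^'d \<Rightarrow> real \<Rightarrow> nat \<Rightarrow> (int^'d) list set" where
  "near \<theta> \<epsilon> n = {s \<in> paths n. (1 / real n) *\<^sub>R to_real_vec (sum_list s) \<in> ball (xi \<theta>) \<epsilon>}"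

lemma near_subset: "near \<theta> \<epsilon> n \<subseteq> paths n" by (auto simp: near_def)

text \<open>The expectation is the probability that the walk with independent tilted steps has
  empirical velocity within \<open>\<epsilon>\<close> of its mean \<open>xi \<theta>\<close>, so
  Chebyshev's inequality applies; \<open>N\<close> makes the failure probability at most
  1/2.\<close>

lemma eventually_expectation_Z_ge:
  assumes \<epsilon>: "\<epsilon> > 0"
  shows "eventually (\<lambda>n. P.expectation (Z \<theta> n (near \<theta> \<epsilon> n)) \<ge> 1/2) sequentially"
proof -
  define p where "p = (\<lambda>z. q z * tilt \<theta> z)"
  have pp: "p z \<ge> 0" if "z \<in> steps" for z using q_pos[OF that] tilt_pos[of \<theta> z] by (simp add: p_def)
  define v where "v = (\<Sum>z\<in>steps. p z * (norm (to_real_vec z - xi \<theta>))\<^sup>2)"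
  obtain N :: nat where N: "real N > 2 * v / \<epsilon>\<^sup>2" using reals_Archimedean2 by blast
  have "P.expectation (Z \<theta> n (near \<theta> \<epsilon> n)) \<ge> 1/2" if n: "n \<ge> Suc N" for n
  proof -
    let ?P = "\<lambda>s. \<Prod>j<n. p (s ! j)" and ?Q = "near \<theta> \<epsilon> n"
    have Pnn: "?P s \<ge> 0" if "s \<in> paths n" for s
      using nth_paths[OF that] pp by (intro prod_nonneg) auto
    have n0: "n > 0" using n by simp
    have far: "(real n * \<epsilon>)\<^sup>2 * ?P s \<le> ?P s * (norm (0 + to_real_vec (sum_list s) - real n *\<^sub>R xi \<theta>))\<^sup>2"
      if s: "s \<in> paths n - ?Q" for s
    proof -
      have "\<epsilon> \<le> norm ((1 / real n) *\<^sub>R to_real_vec (sum_list s) - xi \<theta>)"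
        using s by (auto simp: near_def dist_norm norm_minus_commute)
      also have "(1 / real n) *\<^sub>R to_real_vec (sum_list s) - xi \<theta> =
         (1 / real n) *\<^sub>R (to_real_vec (sum_list s) - real n *\<^sub>R xi \<theta>)"
        using n0 by (simp add: scaleR_diff_right)
      also have "norm \<dots> = norm (to_real_vec (sum_list s) - real n *\<^sub>R xi \<theta>) / real n"
        by (simp only: norm_scaleR) simp
      finally have "real n * \<epsilon> \<le> norm (to_real_vec (sum_list s) - real n *\<^sub>R xi \<theta>)"
        using n0 by (simp add: field_simps)
      then have "(real n * \<epsilon>)\<^sup>2 \<le> (norm (to_real_vec (sum_list s) - real n *\<^sub>R xi \<theta>))\<^sup>2"
        using \<epsilon> by (intro power_mono) auto
      from mult_left_mono[OF this Pnn[of s]] s show ?thesis by (simp add: mult.commute)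
    qed
    have "(real n * \<epsilon>)\<^sup>2 * (\<Sum>s\<in>paths n - ?Q. ?P s) \<le>
       (\<Sum>s\<in>paths n - ?Q. ?P s * (norm (0 + to_real_vec (sum_list s) - real n *\<^sub>R xi \<theta>))\<^sup>2)"
      unfolding sum_distrib_left by (intro sum_mono far)
    also have "\<dots> \<le> (\<Sum>s\<in>paths n. ?P s * (norm (0 + to_real_vec (sum_list s) - real n *\<^sub>R xi \<theta>))\<^sup>2)"
      using Pnn by (intro sum_mono2) auto
    also have "\<dots> = real n * v"
      using sum_paths_variance[of p n 0] sum_q_tilt[of \<theta>] by (simp add: v_def p_def xi_def)
    finally have *: "(real n * \<epsilon>)\<^sup>2 * (\<Sum>s\<in>paths n - ?Q. ?P s) \<le> real n * v" .
    have "2 * v \<le> real n * \<epsilon>\<^sup>2"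
    proof -
      have "2 * v < real N * \<epsilon>\<^sup>2" using N \<epsilon> by (simp add: field_simps)
      also have "\<dots> \<le> real n * \<epsilon>\<^sup>2" using n by (intro mult_right_mono) auto
      finally show ?thesis by simp
    qed
    then have "real n * (2 * v) \<le> (real n * \<epsilon>)\<^sup>2"
      using n0 by (simp add: power_mult_distrib power2_eq_square[of "real n"] mult.assoc)
    with * have "(real n * \<epsilon>)\<^sup>2 * (\<Sum>s\<in>paths n - ?Q. ?P s) \<le> (real n * \<epsilon>)\<^sup>2 * (1/2)" by simp
    then have "(\<Sum>s\<in>paths n - ?Q. ?P s) \<le> 1/2"
      using n0 \<epsilon> by (subst (asm) mult_le_cancel_left_pos) auto
    moreover have "(\<Sum>s\<in>paths n - ?Q. ?P s) = (\<Sum>s\<in>paths n. ?P s) - (\<Sum>s\<in>?Q. ?P s)"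
      by (rule sum_diff) (auto simp: near_def)
    moreover have "(\<Sum>s\<in>paths n. ?P s) = 1"
      unfolding sum_paths_prod using sum_q_tilt[of \<theta>] by (simp add: p_def)
    ultimately show ?thesis
      by (simp add: expectation_Z[OF near_subset] p_def)
  qed
  then show ?thesis unfolding eventually_sequentially by blast
qed

text \<open>The second moment method of Paley and Zygmund, through a pointwise bound of Z by
  1/4 + Z^2/(8C) + 2C 1[Z >= 1/4].\<close>
lemma prob_Z_ge:
  assumes Q: "Q \<subseteq> paths n" and C: "C \<ge> 1"
    and E1: "P.expectation (Z \<theta> n Q) \<ge> 1/2" and E2: "P.expectation (\<lambda>\<omega>. (Z \<theta> n Q \<omega>)\<^sup>2) \<le> C"
  shows "P.prob {\<omega>\<in>space PP. Z \<theta> n Q \<omega> \<ge> 1/4} \<ge> 1 / (16 * C)"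
proof -
  define A where "A = {\<omega>\<in>space PP. Z \<theta> n Q \<omega> \<ge> 1/4}"
  have A: "A \<in> sets PP" unfolding A_def using measurable_Z[OF Q] by measurable
  have intA: "integrable PP (indicat_real A)" using A by (simp add: P.emeasure_eq_measure)
  have "Z \<theta> n Q \<omega> \<le> 1/4 + (Z \<theta> n Q \<omega>)\<^sup>2 / (8 * C) + 2 * C * indicator A \<omega>" if om: "\<omega> \<in> space PP" for \<omega>
  proof (cases "\<omega> \<in> A")
    case True
    have "0 \<le> (Z \<theta> n Q \<omega> - 4 * C)\<^sup>2" by simp
    then have "8 * C * Z \<theta> n Q \<omega> \<le> (Z \<theta> n Q \<omega>)\<^sup>2 + 16 * C\<^sup>2" by (simp add: power2_eq_square algebra_simps)
    then have "Z \<theta> n Q \<omega> \<le> ((Z \<theta> n Q \<omega>)\<^sup>2 + 16 * C\<^sup>2) / (8 * C)" using C by (simp add: field_simps)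
    also have "\<dots> = (Z \<theta> n Q \<omega>)\<^sup>2 / (8 * C) + 2 * C" using C by (simp add: field_simps power2_eq_square)
    finally show ?thesis using True by simp
  next
    case False
    then show ?thesis using om C by (simp add: A_def add_increasing2)
  qed
  then have "P.expectation (Z \<theta> n Q) \<le> P.expectation (\<lambda>\<omega>. 1/4 + (Z \<theta> n Q \<omega>)\<^sup>2 / (8 * C) + 2 * C * indicator A \<omega>)"
    using intA integrable_Z[OF Q] integrable_Z_square[OF Q]
    by (intro integral_mono) (auto intro!: Bochner_Integration.integrable_add)
  also have "\<dots> = 1/4 + P.expectation (\<lambda>\<omega>. (Z \<theta> n Q \<omega>)\<^sup>2) / (8 * C) + 2 * C * P.prob A"
  proof -
    have "P.expectation (\<lambda>\<omega>. 1/4 + (Z \<theta> n Q \<omega>)\<^sup>2 / (8 * C) + 2 * C * indicator A \<omega>)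
       = P.expectation (\<lambda>\<omega>. 1/4 + (Z \<theta> n Q \<omega>)\<^sup>2 / (8 * C)) + P.expectation (\<lambda>\<omega>. 2 * C * indicator A \<omega>)"
      using intA integrable_Z_square[OF Q] by (intro Bochner_Integration.integral_add) auto
    also have "P.expectation (\<lambda>\<omega>. 1/4 + (Z \<theta> n Q \<omega>)\<^sup>2 / (8 * C))
       = P.expectation (\<lambda>\<omega>. 1/4) + P.expectation (\<lambda>\<omega>. (Z \<theta> n Q \<omega>)\<^sup>2 / (8 * C))"
      using integrable_Z_square[OF Q] by (intro Bochner_Integration.integral_add) auto
    finally show ?thesis using A prob_PP by simp
  qed
  also have "P.expectation (\<lambda>\<omega>. (Z \<theta> n Q \<omega>)\<^sup>2) / (8 * C) \<le> 1/8"
    using E2 C by (simp add: field_simps)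
  finally have "1/8 \<le> 2 * C * P.prob A" using E1 by simp
  then show ?thesis using C by (simp add: A_def field_simps)
qed

section \<open>Concentration of the tilted partition function\<close>

text \<open>Every path reads at most one factor from layer \<open>i\<close>, and both versions of it
  lie between \<open>c1\<close> and 1. The loss is uniform over paths, so it passes to
  \<open>Z\<close>.\<close>

lemma c1_path_prob_le:
  assumes s: "s \<in> paths n" and eq: "\<And>j x. j < n \<Longrightarrow> j \<noteq> i \<Longrightarrow> \<omega> (int j, x) = \<omega>' (int j, x)"
  shows "c1 * path_prob (cl \<omega>) 0 0 s \<le> path_prob (cl \<omega>') 0 0 s"
proof -
  define a where "a = (\<lambda>\<omega> j. cl \<omega> (0 + int j, 0 + sum_list (take j s)) (s ! j))"
  have bounds: "0 < a \<omega> j" "a \<omega> j \<le> 1" "c1 \<le> a \<omega> j" if "j < n" for j \<omega>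
    using nth_paths[OF s that] clamp_pos clamp_le_1 clamp_ge by (auto simp: cl_def a_def)
  have same: "a \<omega> j = a \<omega>' j" if "j < n" "j \<noteq> i" for j
    using eq[OF that] by (simp add: cl_def a_def)
  have pp: "path_prob (cl \<omega>) 0 0 s = (\<Prod>j<n. a \<omega> j)" for \<omega>
    by (simp add: path_prob_def length_paths[OF s] a_def)
  show ?thesis
  proof (cases "i < n")
    case True
    have split: "(\<Prod>j<n. a \<omega> j) = a \<omega> i * (\<Prod>j\<in>{..<n}-{i}. a \<omega> j)" for \<omega>
      using True by (intro prod.remove) auto
    have rest: "(\<Prod>j\<in>{..<n}-{i}. a \<omega> j) = (\<Prod>j\<in>{..<n}-{i}. a \<omega>' j)"
      by (rule prod.cong) (use same in auto)
    have "c1 * a \<omega> i \<le> c1 * 1" using bounds(2)[OF True] c1_pos by (intro mult_left_mono) auto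
    also have "\<dots> \<le> a \<omega>' i" using bounds(3)[OF True] by simp
    finally have "(c1 * a \<omega> i) * (\<Prod>j\<in>{..<n}-{i}. a \<omega>' j) \<le> a \<omega>' i * (\<Prod>j\<in>{..<n}-{i}. a \<omega>' j)"
      using bounds(1) by (intro mult_right_mono prod_nonneg) (auto intro: less_imp_le)
    then show ?thesis unfolding pp split rest by (simp only: mult.assoc)
  next
    case False
    have "path_prob (cl \<omega>) 0 0 s = path_prob (cl \<omega>') 0 0 s"
      unfolding pp by (rule prod.cong) (use same False in auto)
    then show ?thesis using c1_le_1 path_prob_bounds(2)[OF s, of \<omega>' 0 0] by simp
  qed
qed

lemma c1_Z_le:
  assumes Q: "Q \<subseteq> paths n" and eq: "\<And>j x. j < n \<Longrightarrow> j \<noteq> i \<Longrightarrow> \<omega> (int j, x) = \<omega>' (int j, x)"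
  shows "c1 * Z \<theta> n Q \<omega> \<le> Z \<theta> n Q \<omega>'"
  unfolding Z_def sum_distrib_left
proof (rule sum_mono)
  fix s assume "s \<in> Q"
  then have s: "s \<in> paths n" using Q by auto
  have "c1 * path_prob (cl \<omega>) 0 0 s \<le> path_prob (cl \<omega>') 0 0 s"
    by (rule c1_path_prob_le[OF s, of i]) (rule eq)
  then have "weight \<theta> n s * (c1 * path_prob (cl \<omega>) 0 0 s) \<le> weight \<theta> n s * path_prob (cl \<omega>') 0 0 s"
    by (rule mult_left_mono) (rule less_imp_le[OF weight_pos])
  then show "c1 * (weight \<theta> n s * path_prob (cl \<omega>) 0 0 s) \<le> weight \<theta> n s * path_prob (cl \<omega>') 0 0 s"
    by (simp add: mult_ac)
qed

lemma Z_cong: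
  assumes Q: "Q \<subseteq> paths n" and eq: "\<And>j x. j < n \<Longrightarrow> \<omega> (int j, x) = \<omega>' (int j, x)"
  shows "Z \<theta> n Q \<omega> = Z \<theta> n Q \<omega>'"
  unfolding Z_def
proof (rule sum.cong)
  fix s assume "s \<in> Q"
  then have "length s = n" using Q length_paths by auto
  then show "weight \<theta> n s * path_prob (cl \<omega>) 0 0 s = weight \<theta> n s * path_prob (cl \<omega>') 0 0 s"
    by (simp add: path_prob_def cl_def eq)
qed simp

text \<open>Crude bounds depending on \<open>n\<close>, whose purpose is to make \<open>ln Z\<close>
  a bounded function, as McDiarmid's inequality requires.\<close>

lemma Z_bounds:
  assumes Q: "Q \<subseteq> paths n" "Q \<noteq> {}"
  shows "0 < (\<Sum>s\<in>Q. weight \<theta> n s * c1 ^ n)" "(\<Sum>s\<in>Q. weight \<theta> n s * c1 ^ n) \<le> Z \<theta> n Q \<omega>"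
    "Z \<theta> n Q \<omega> \<le> (\<Sum>s\<in>Q. weight \<theta> n s)" "0 < Z \<theta> n Q \<omega>"
proof -
  have fin: "finite Q" using Q(1) by (rule finite_subset) simp
  show 1: "0 < (\<Sum>s\<in>Q. weight \<theta> n s * c1 ^ n)"
    using fin Q weight_pos c1_pos by (intro sum_pos) auto
  show 2: "(\<Sum>s\<in>Q. weight \<theta> n s * c1 ^ n) \<le> Z \<theta> n Q \<omega>"
    unfolding Z_def using Q path_prob_bounds(1) weight_pos
    by (intro sum_mono mult_left_mono) (auto intro: less_imp_le)
  show "Z \<theta> n Q \<omega> \<le> (\<Sum>s\<in>Q. weight \<theta> n s)"
    unfolding Z_def
  proof (rule sum_mono)
    fix s assume "s \<in> Q"
    then have "path_prob (cl \<omega>) 0 0 s \<le> 1" using Q path_prob_bounds(3) by auto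
    from mult_left_mono[OF this less_imp_le[OF weight_pos]]
    show "weight \<theta> n s * path_prob (cl \<omega>) 0 0 s \<le> weight \<theta> n s" by simp
  qed
  show "0 < Z \<theta> n Q \<omega>" using 1 2 by linarith
qed

text \<open>Changing one layer moves \<open>ln Z\<close> by at most \<open>ln (1 / c1)\<close>; the
  added 1 gives strict positivity from \<open>c1 \<le> 1\<close> alone.\<close>

definition osc :: real where "osc = 1 + ln (1 / c1)"

lemma osc_pos: "osc > 0"
proof -
  have "0 \<le> ln (1 / c1)" by (rule ln_ge_zero) (use c1_pos c1_le_1 in simp)
  then show ?thesis by (simp add: osc_def)
qed

text \<open>The independent inputs are the \<open>n\<close> time layers, not the far more numerous
  single rows; this makes the exponent of order \<open>t\<^sup>2 / n\<close>.\<close>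

lemma ln_Z_concentration:
  fixes t :: real and \<theta> :: "real^'d"
  assumes Q: "Q \<subseteq> paths n" "Q \<noteq> {}" and n: "n > 0" and t: "t > 0"
  defines "f \<equiv> \<lambda>\<omega>. ln (Z \<theta> n Q \<omega>)"
  shows "P.prob {\<omega>\<in>space PP. f \<omega> - P.expectation f \<ge> t} \<le> exp (- (t\<^sup>2 / (2 * real n * osc\<^sup>2)))"
    and "P.prob {\<omega>\<in>space PP. f \<omega> - P.expectation f \<le> - t} \<le> exp (- (t\<^sup>2 / (2 * real n * osc\<^sup>2)))"
proof -
  define N where "N = (\<lambda>j::nat. PiM (layer (0 + int j)) (\<lambda>_. \<mu>))"
  define X where "X = (\<lambda>(j::nat) (\<omega>::'d env). restrict \<omega> (layer (0 + int j)))"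
  \<comment> \<open>Glues a sequence of layers into an environment. The truncation of negative times
    by \<open>nat\<close> is harmless since \<open>Z\<close> reads only times from 0 to
    \<open>n - 1\<close>.\<close>
  define asm where "asm = (\<lambda>(l :: nat \<Rightarrow> 'd env) (p :: int \<times> (int^'d)). l (nat (fst p)) p)"
  define F where "F = (\<lambda>l. ln (Z \<theta> n Q (asm l)))"
  have ind: "P.indep_vars N X {..<n}"
    unfolding N_def X_def by (rule indep_layers)
  have cl_asm: "(\<lambda>l. cl (asm l) (0 + int j, x) z) \<in> borel_measurable (PiM {..<n} N)"
    if "z \<in> steps" "j < n" for j x z
  proof -
    have 1: "(\<lambda>l. l j) \<in> measurable (PiM {..<n} N) (PiM (layer (0 + int j)) (\<lambda>_. \<mu>))"
      using measurable_component_singleton[of j "{..<n}" N] that by (simp add: N_def)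
    have 2: "(\<lambda>\<omega>. clamp (\<omega> (0 + int j, x)) z) \<in> borel_measurable (PiM (layer (0 + int j)) (\<lambda>_. \<mu>))"
      by (rule measurable_clamp_coord) (use that in \<open>auto simp: layer_def\<close>)
    show ?thesis using measurable_compose[OF 1 2] by (simp add: cl_def asm_def)
  qed
  have F: "F \<in> borel_measurable (PiM {..<n} N)"
    unfolding F_def Z_def path_prob_def
  proof (intro borel_measurable_ln borel_measurable_sum borel_measurable_times borel_measurable_prod cl_asm)
    fix s j assume "s \<in> Q" "j \<in> {..<length s}"
    then show "s ! j \<in> steps" "j < n" using Q nth_paths[of s n j] length_paths[of s n] by auto
  qed auto
  define C where "C = \<bar>ln (\<Sum>s\<in>Q. weight \<theta> n s * c1 ^ n)\<bar> + \<bar>ln (\<Sum>s\<in>Q. weight \<theta> n s)\<bar>"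
  have C: "\<bar>F l\<bar> \<le> C" for l
  proof -
    note b = Z_bounds[OF Q, of \<theta>]
    have "ln (\<Sum>s\<in>Q. weight \<theta> n s * c1 ^ n) \<le> F l"
      unfolding F_def using b(2)[of "asm l"] b(1) by (rule ln_mono)
    moreover have "F l \<le> ln (\<Sum>s\<in>Q. weight \<theta> n s)"
      unfolding F_def using b(3)[of "asm l"] b(4)[of "asm l"] by (rule ln_mono)
    ultimately show ?thesis unfolding C_def by linarith
  qed
  have FD: "\<bar>F (l(i := y)) - F l\<bar> \<le> osc" for l i y
  proof -
    have *: "F l \<le> F l' + osc" if eq: "\<And>j. j \<noteq> i \<Longrightarrow> l j = l' j" for l l'
    proof -
      have "c1 * Z \<theta> n Q (asm l) \<le> Z \<theta> n Q (asm l')"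
        by (rule c1_Z_le[OF Q(1), of i]) (simp add: asm_def eq)
      moreover have "0 < c1 * Z \<theta> n Q (asm l)" using Z_bounds(4)[OF Q] c1_pos by simp
      ultimately have "ln (c1 * Z \<theta> n Q (asm l)) \<le> ln (Z \<theta> n Q (asm l'))"
        by (intro ln_mono)
      then show ?thesis
        using Z_bounds(4)[OF Q, of \<theta> "asm l"] c1_pos by (simp add: F_def osc_def ln_mult ln_div)
    qed
    show ?thesis using *[of "l(i := y)" l] *[of l "l(i := y)"] by (auto simp: abs_le_iff)
  qed
  have f: "f = (\<lambda>\<omega>. F (\<lambda>j\<in>{..<n}. X j \<omega>))"
    unfolding f_def F_def
    by (intro ext arg_cong[where f = ln] Z_cong[OF Q(1)]) (simp add: asm_def X_def layer_def)
  show "P.prob {\<omega>\<in>space PP. f \<omega> - P.expectation f \<ge> t} \<le> exp (- (t\<^sup>2 / (2 * real n * osc\<^sup>2)))"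
  proof -
    have "P.prob {\<omega>\<in>space PP. f \<omega> - P.expectation f \<ge> t} \<le> exp (- (t\<^sup>2 / (real (2 * card {..<n}) * osc\<^sup>2)))"
      unfolding f by (rule P.mcdiarmid_upper[where F = F and X = X and N = N and I = "{..<n}" and C = C and D = osc and t = t]) (rule ind F C FD osc_pos t finite_lessThan | use n in force)+
    then show ?thesis by simp
  qed
  show "P.prob {\<omega>\<in>space PP. f \<omega> - P.expectation f \<le> - t} \<le> exp (- (t\<^sup>2 / (2 * real n * osc\<^sup>2)))"
  proof -
    have "P.prob {\<omega>\<in>space PP. f \<omega> - P.expectation f \<le> - t} \<le> exp (- (t\<^sup>2 / (real (2 * card {..<n}) * osc\<^sup>2)))"
      unfolding f by (rule P.mcdiarmid_lower[where F = F and X = X and N = N and I = "{..<n}" and C = C and D = osc and t = t]) (rule ind F C FD osc_pos t finite_lessThan | use n in force)+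
    then show ?thesis by simp
  qed
qed

text \<open>If the mean of \<open>ln Z\<close> lay below \<open>- ln 4 - t\<close>, the event
  \<open>Z \<ge> 1/4\<close> would be an exponentially unlikely upper deviation, against its
  probability \<open>1 / (16 * C)\<close>. With the mean thus bounded below, the lower tail is
  summable and Borel-Cantelli applies.\<close>

lemma AE_eventually_Z_ge:
  assumes h: "\<And>x. h x \<ge> 1" and \<epsilon>: "\<epsilon> > 0" and \<eta>: "\<eta> > 0"
    and sup: "\<And>x. (\<Sum>z\<in>steps. \<Sum>w\<in>steps. pair_kernel x z w * (tilt \<theta> z * tilt \<theta> w) * h (x + z - w)) \<le> h x"
  shows "AE \<omega> in PP. eventually (\<lambda>n. Z \<theta> n (near \<theta> \<epsilon> n) \<omega> \<ge> exp (- \<eta> * real n)) sequentially"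
proof -
  define C where "C = h 0"
  have C: "C \<ge> 1" using h by (simp add: C_def)
  \<comment> \<open>The McDiarmid exponent \<open>t\<^sup>2 / (2 * n * osc\<^sup>2)\<close> per unit
    of time at \<open>t = \<eta> * n / 3\<close>.\<close>
  define \<kappa> where "\<kappa> = \<eta>\<^sup>2 / (18 * osc\<^sup>2)"
  have \<kappa>: "\<kappa> > 0" using \<eta> osc_pos by (simp add: \<kappa>_def)
  define A where "A = (\<lambda>n. {\<omega>\<in>space PP. Z \<theta> n (near \<theta> \<epsilon> n) \<omega> < exp (- \<eta> * real n)})"
  have A: "A n \<in> sets PP" for n
  proof -
    note [measurable] = measurable_Z[OF near_subset, where \<theta> = \<theta>]
    show ?thesis unfolding A_def by measurable
  qed
  have lim: "(\<lambda>n. exp (- \<kappa> * real n)) \<longlonglongrightarrow> 0"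
    using \<kappa> by real_asymp
  have "eventually (\<lambda>n. exp (- \<kappa> * real n) < 1 / (16 * C)) sequentially"
    by (rule order_tendstoD(2)[OF lim]) (use C in auto)
  moreover have "eventually (\<lambda>n. \<eta> / 3 * real n \<ge> ln 4) sequentially"
    using \<eta> by real_asymp
  moreover have "eventually (\<lambda>n. n > (0::nat)) sequentially" by (rule eventually_gt_at_top)
  ultimately have "eventually (\<lambda>n. P.prob (A n) \<le> exp (- \<kappa> * real n)) sequentially"
    using eventually_expectation_Z_ge[OF \<epsilon>, of \<theta>]
  proof eventually_elim
    case (elim n)
    define Q where "Q = near \<theta> \<epsilon> n"
    define f where "f = (\<lambda>\<omega>. ln (Z \<theta> n Q \<omega>))"
    \<comment> \<open>Thirds of the budget \<open>\<eta> * n\<close>: one for \<open>ln 4\<close>,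
      one for the gap between \<open>- ln 4\<close> and the mean, one for the deviation below the
      mean.\<close>
    define t where "t = \<eta> / 3 * real n"
    note elim = elim[folded Q_def t_def]
    have Q: "Q \<subseteq> paths n" unfolding Q_def by (rule near_subset)
    have Qne: "Q \<noteq> {}"
    proof
      assume "Q = {}"
      then have "Z \<theta> n Q = (\<lambda>_. 0)" by (simp add: Z_def[abs_def])
      then show False using elim(4) by simp
    qed
    have t: "t > 0" using \<eta> elim(3) by (simp add: t_def)
    have rate: "- (t\<^sup>2 / (2 * real n * osc\<^sup>2)) = - \<kappa> * real n"
      using elim(3) osc_pos by (simp add: \<kappa>_def t_def field_simps power2_eq_square)
    have conc: "P.prob {\<omega>\<in>space PP. f \<omega> - P.expectation f \<ge> t} \<le> exp (- \<kappa> * real n)"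
      "P.prob {\<omega>\<in>space PP. f \<omega> - P.expectation f \<le> - t} \<le> exp (- \<kappa> * real n)"
      unfolding f_def rate[symmetric] by (rule ln_Z_concentration[OF Q Qne elim(3) t])+
    note [measurable] = measurable_Z[OF Q, of \<theta>]
    have f[measurable]: "f \<in> borel_measurable PP" unfolding f_def by measurable
    note Zpos = Z_bounds(4)[OF Q Qne]
    have Ef: "P.expectation f \<ge> - ln 4 - t"
    proof (rule ccontr)
      assume neg: "\<not> ?thesis"
      have "1 / (16 * C) \<le> P.prob {\<omega>\<in>space PP. Z \<theta> n Q \<omega> \<ge> 1/4}"
        using prob_Z_ge[OF Q C elim(4)] expectation_Z_square_le[of h, OF h Q sup] by (simp add: C_def)
      also have "\<dots> \<le> P.prob {\<omega>\<in>space PP. f \<omega> - P.expectation f \<ge> t}"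
      proof (rule P.finite_measure_mono)
        show "{\<omega>\<in>space PP. Z \<theta> n Q \<omega> \<ge> 1/4} \<subseteq> {\<omega>\<in>space PP. f \<omega> - P.expectation f \<ge> t}"
        proof safe
          fix \<omega> assume "Z \<theta> n Q \<omega> \<ge> 1/4"
          then have "ln (1/4) \<le> f \<omega>" unfolding f_def by (intro ln_mono) auto
          then show "t \<le> f \<omega> - P.expectation f" using neg by (simp add: ln_div)
        qed
      qed measurable
      also have "\<dots> \<le> exp (- \<kappa> * real n)" by (rule conc(1))
      finally show False using elim(1) by simp
    qed
    have "P.prob (A n) \<le> P.prob {\<omega>\<in>space PP. f \<omega> - P.expectation f \<le> - t}"
    proof (rule P.finite_measure_mono)
      show "A n \<subseteq> {\<omega>\<in>space PP. f \<omega> - P.expectation f \<le> - t}"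
      proof
        fix \<omega> assume "\<omega> \<in> A n"
        then have 1: "\<omega> \<in> space PP" "Z \<theta> n Q \<omega> < exp (- \<eta> * real n)" by (auto simp: A_def Q_def)
        then have "f \<omega> < ln (exp (- \<eta> * real n))" unfolding f_def using Zpos by (subst ln_less_cancel_iff) auto
        then have "f \<omega> < - 3 * t" by (simp add: t_def)
        then show "\<omega> \<in> {\<omega>\<in>space PP. f \<omega> - P.expectation f \<le> - t}" using Ef elim(2) 1 by simp
      qed
    qed measurable
    also have "\<dots> \<le> exp (- \<kappa> * real n)" by (rule conc(2))
    finally show ?case .
  qed
  then obtain N where N: "\<And>n. n \<ge> N \<Longrightarrow> P.prob (A n) \<le> exp (- \<kappa> * real n)"
    unfolding eventually_sequentially by blast
  have "summable (\<lambda>n. exp (- \<kappa>) ^ n)" by (rule summable_geometric) (use \<kappa> in auto)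
  then have "summable (\<lambda>n. exp (- \<kappa> * real n))" by (simp add: exp_of_nat_mult[symmetric] mult.commute)
  then have "summable (\<lambda>n. P.prob (A n))"
    by (rule summable_comparison_test'[where N = N]) (use N in auto)
  then have "AE \<omega> in PP. eventually (\<lambda>n. \<omega> \<in> space PP - A n) sequentially"
    by (intro borel_cantelli_AE1 A) (auto simp: P.emeasure_eq_measure)
  then show ?thesis
    by eventually_elim (auto simp: A_def elim!: eventually_mono)
qed

text \<open>Undoes the tilt: the weight depends on the endpoint only, and on endpoints within
  \<open>\<epsilon>\<close> of \<open>xi \<theta>\<close> it is at most \<open>K\<close>, the price
  being \<open>norm \<theta> * \<epsilon>\<close> in the rate.\<close>

lemma quenched_prob_ge:
  assumes n: "n > 0" and Z: "Z \<theta> n (near \<theta> \<epsilon> n) \<omega> \<ge> exp (- \<eta> * real n)"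
  shows "quenched_prob (cl \<omega>) 0 0 n {y. (1 / real n) *\<^sub>R to_real_vec y \<in> ball (xi \<theta>) \<epsilon>}
    \<ge> exp (- (real n * (\<theta> \<bullet> xi \<theta> - \<Lambda> \<theta> + norm \<theta> * \<epsilon> + \<eta>)))"
proof -
  define K where "K = exp (real n * (\<theta> \<bullet> xi \<theta> - \<Lambda> \<theta> + norm \<theta> * \<epsilon>))"
  have w: "weight \<theta> n s \<le> K" if s: "s \<in> near \<theta> \<epsilon> n" for s
  proof -
    let ?y = "(1 / real n) *\<^sub>R to_real_vec (sum_list s)"
    have "\<theta> \<bullet> (?y - xi \<theta>) \<le> norm \<theta> * norm (?y - xi \<theta>)" by (rule norm_cauchy_schwarz)
    also have "\<dots> \<le> norm \<theta> * \<epsilon>"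
      using s by (intro mult_left_mono) (auto simp: near_def dist_norm norm_minus_commute)
    finally have "\<theta> \<bullet> ?y \<le> \<theta> \<bullet> xi \<theta> + norm \<theta> * \<epsilon>" by (simp add: inner_diff_right)
    then have "real n * (\<theta> \<bullet> ?y) \<le> real n * (\<theta> \<bullet> xi \<theta> + norm \<theta> * \<epsilon>)" by (rule mult_left_mono) simp
    moreover have "real n * (\<theta> \<bullet> ?y) = \<theta> \<bullet> to_real_vec (sum_list s)" using n by simp
    ultimately show ?thesis by (simp add: weight_def K_def algebra_simps)
  qed
  have "exp (- \<eta> * real n) \<le> Z \<theta> n (near \<theta> \<epsilon> n) \<omega>" by (rule Z)
  also have "\<dots> \<le> (\<Sum>s\<in>near \<theta> \<epsilon> n. K * path_prob (cl \<omega>) 0 0 s)"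
    unfolding Z_def using less_imp_le[OF path_prob_bounds(2)[OF subsetD[OF near_subset]]]
    by (intro sum_mono mult_right_mono w)
  also have "\<dots> = K * quenched_prob (cl \<omega>) 0 0 n {y. (1 / real n) *\<^sub>R to_real_vec y \<in> ball (xi \<theta>) \<epsilon>}"
    unfolding quenched_prob_eq sum_distrib_left[symmetric] near_def
    by (subst sum.inter_filter) auto
  finally have "exp (- \<eta> * real n) / K \<le> quenched_prob (cl \<omega>) 0 0 n {y. (1 / real n) *\<^sub>R to_real_vec y \<in> ball (xi \<theta>) \<epsilon>}"
    by (simp add: K_def field_simps)
  moreover have "exp (- \<eta> * real n) / K = exp (- (real n * (\<theta> \<bullet> xi \<theta> - \<Lambda> \<theta> + norm \<theta> * \<epsilon> + \<eta>)))"
    by (simp add: K_def algebra_simps flip: exp_diff)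
  ultimately show ?thesis by simp
qed

section \<open>Upper bound\<close>

lemma sum_list_paths_bound: "s \<in> paths n \<Longrightarrow> \<bar>sum_list s $ i\<bar> \<le> int n"
proof (induction s arbitrary: n)
  case (Cons z s)
  then obtain m where m: "n = Suc m" "s \<in> paths m" "z \<in> steps" by (cases n) (auto simp: paths_def)
  have "\<bar>sum_list s $ i\<bar> \<le> int m" by (rule Cons.IH[OF m(2)])
  then show ?case using step_component_le[OF m(3), of i] m(1) by simp
qed simp

definition reach :: "nat \<Rightarrow> (int^'d) set" where
  "reach n = sum_list ` paths n"

lemma finite_reach [simp]: "finite (reach n)" by (simp add: reach_def)

lemma card_reach_le: "card (reach n) \<le> (2 * n + 1) ^ CARD('d)"
proof -
  have "card (reach n) \<le> card {y :: int^'d. \<forall>i. \<bar>y $ i\<bar> \<le> int n}"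
    by (intro card_mono finite_box) (use sum_list_paths_bound in \<open>auto simp: reach_def\<close>)
  also have "\<dots> \<le> card {- int n..int n} ^ CARD('d)" by (rule card_box_le)
  also have "card {- int n..int n} = 2 * n + 1" by simp
  finally show ?thesis .
qed

definition avg_prob :: "nat \<Rightarrow> int^'d \<Rightarrow> real" where
  "avg_prob n y = (\<Sum>s\<in>{s\<in>paths n. sum_list s = y}. \<Prod>j<n. q (s ! j))"

lemma prod_q_pos: "s \<in> paths n \<Longrightarrow> 0 < (\<Prod>j<n. q (s ! j))"
  by (intro prod_pos q_pos nth_paths) auto

lemma avg_prob_pos: "y \<in> reach n \<Longrightarrow> avg_prob n y > 0"
  unfolding avg_prob_def using prod_q_pos by (intro sum_pos) (auto simp: reach_def)

lemma quenched_point: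
  "quenched_prob \<omega> 0 0 n {y} = (\<Sum>s\<in>{s\<in>paths n. sum_list s = y}. path_prob \<omega> 0 0 s)"
  unfolding quenched_prob_eq by (subst sum.inter_filter) auto

lemma expectation_quenched_point:
  "integrable PP (\<lambda>\<omega>. quenched_prob (cl \<omega>) 0 0 n {y})"
  "P.expectation (\<lambda>\<omega>. quenched_prob (cl \<omega>) 0 0 n {y}) = avg_prob n y"
proof -
  show "integrable PP (\<lambda>\<omega>. quenched_prob (cl \<omega>) 0 0 n {y})"
    unfolding quenched_point by (intro Bochner_Integration.integrable_sum integrable_path_prob) auto
  have "P.expectation (\<lambda>\<omega>. quenched_prob (cl \<omega>) 0 0 n {y})
      = (\<Sum>s\<in>{s\<in>paths n. sum_list s = y}. P.expectation (\<lambda>\<omega>. path_prob (cl \<omega>) 0 0 s))"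
    unfolding quenched_point by (intro Bochner_Integration.integral_sum integrable_path_prob) auto
  also have "\<dots> = avg_prob n y"
    unfolding avg_prob_def by (intro sum.cong refl expectation_path) auto
  finally show "P.expectation (\<lambda>\<omega>. quenched_prob (cl \<omega>) 0 0 n {y}) = avg_prob n y" .
qed

lemma quenched_prob_eq_sum_reach:
  "quenched_prob \<omega> 0 0 n A = (\<Sum>y\<in>reach n \<inter> A. quenched_prob \<omega> 0 0 n {y})"
proof -
  have "(\<Sum>y\<in>reach n \<inter> A. quenched_prob \<omega> 0 0 n {y}) =
    (\<Sum>y\<in>reach n \<inter> A. \<Sum>s\<in>{s\<in>{s\<in>paths n. sum_list s \<in> A}. sum_list s = y}. path_prob \<omega> 0 0 s)"
    unfolding quenched_point by (intro sum.cong refl) auto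
  also have "\<dots> = (\<Sum>s\<in>{s\<in>paths n. sum_list s \<in> A}. path_prob \<omega> 0 0 s)"
    by (rule sum.group) (auto simp: reach_def)
  also have "\<dots> = quenched_prob \<omega> 0 0 n A"
    unfolding quenched_prob_eq by (subst sum.inter_filter) auto
  finally show ?thesis ..
qed

lemma quenched_prob_nonneg: "quenched_prob (cl \<omega>) 0 0 n A \<ge> 0"
  unfolding quenched_prob_eq using less_imp_le[OF path_prob_bounds(2)]
  by (intro sum_nonneg) auto

text \<open>Chernoff's bound at a single site: the tilted mass of the paths ending at
  \<open>y\<close> is at most 1 for every \<open>\<theta>\<close>, and the supremum over
  \<open>\<theta>\<close> can be taken because the endpoint is fixed.\<close>

lemma avg_prob_le:
  assumes n: "n > 0" and y: "y \<in> reach n" and a: "ereal a \<le> I_c \<mu> ((1 / real n) *\<^sub>R to_real_vec y)"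
  shows "avg_prob n y \<le> exp (- (real n * a))"
proof -
  define p where "p = avg_prob n y"
  have p: "p > 0" unfolding p_def by (rule avg_prob_pos[OF y])
  have *: "p * weight_y \<le> 1" if "weight_y = exp (\<theta> \<bullet> to_real_vec y - real n * \<Lambda> \<theta>)" for \<theta> weight_y
  proof -
    have "p * weight_y = (\<Sum>s\<in>{s\<in>paths n. sum_list s = y}. (\<Prod>j<n. q (s ! j)) * weight \<theta> n s)"
      unfolding p_def avg_prob_def sum_distrib_right that by (intro sum.cong refl) (auto simp: weight_def)
    also have "\<dots> = (\<Sum>s\<in>{s\<in>paths n. sum_list s = y}. \<Prod>j<n. q (s ! j) * tilt \<theta> (s ! j))"
      by (intro sum.cong refl) (simp add: weight_eq_prod length_paths prod.distrib)
    also have "\<dots> \<le> (\<Sum>s\<in>paths n. \<Prod>j<n. q (s ! j) * tilt \<theta> (s ! j))"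
    proof (rule sum_mono2)
      fix s assume "s \<in> paths n - {s\<in>paths n. sum_list s = y}"
      then have "s \<in> paths n" by simp
      from nth_paths[OF this] show "0 \<le> (\<Prod>j<n. q (s ! j) * tilt \<theta> (s ! j))"
        by (intro prod_nonneg mult_nonneg_nonneg less_imp_le[OF q_pos] less_imp_le[OF tilt_pos]) auto
    qed auto
    also have "\<dots> = 1" using sum_paths_prod[of "\<lambda>z. q z * tilt \<theta> z" n] by (simp add: sum_q_tilt)
    finally show ?thesis .
  qed
  have "I_c \<mu> ((1 / real n) *\<^sub>R to_real_vec y) \<le> ereal (- ln p / real n)"
    unfolding I_c_def
  proof (rule SUP_least)
    fix \<theta> :: "real^'d"
    let ?w = "exp (\<theta> \<bullet> to_real_vec y - real n * \<Lambda> \<theta>)"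
    have "ln (p * ?w) \<le> ln 1" using *[OF refl, of \<theta>] p by (intro ln_mono) auto
    then have "ln p + (\<theta> \<bullet> to_real_vec y - real n * \<Lambda> \<theta>) \<le> 0" using p by (simp add: ln_mult)
    then have "(\<theta> \<bullet> to_real_vec y - real n * \<Lambda> \<theta>) / real n \<le> - ln p / real n"
      by (intro divide_right_mono) auto
    then show "ereal (\<theta> \<bullet> ((1 / real n) *\<^sub>R to_real_vec y) - \<Lambda> \<theta>) \<le> ereal (- ln p / real n)"
      using n by (simp add: diff_divide_distrib)
  qed
  with a have "ereal a \<le> ereal (- ln p / real n)" by (rule order_trans)
  then have "ln p \<le> - (real n * a)" using n by (simp add: field_simps)
  then have "exp (ln p) \<le> exp (- (real n * a))" by (simp only: exp_le_cancel_iff)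
  then show ?thesis using p by (simp only: exp_ln p_def)
qed

text \<open>Each summand has mean 1, so the mean is the number of reachable sites. One variable thus
  bounds the ratio of quenched to averaged probability at all sites together.\<close>

definition ratio_sum :: "nat \<Rightarrow> 'd env \<Rightarrow> real" where
  "ratio_sum n \<omega> = (\<Sum>y\<in>reach n. quenched_prob (cl \<omega>) 0 0 n {y} / avg_prob n y)"

lemma ratio_sum_nonneg: "ratio_sum n \<omega> \<ge> 0"
  unfolding ratio_sum_def using less_imp_le[OF avg_prob_pos] quenched_prob_nonneg
  by (intro sum_nonneg divide_nonneg_nonneg) auto

lemma integrable_ratio_sum: "integrable PP (ratio_sum n)"
  unfolding ratio_sum_def[abs_def] using expectation_quenched_point(1)
  by (intro Bochner_Integration.integrable_sum integrable_divide) auto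

lemma expectation_ratio_sum: "P.expectation (ratio_sum n) = real (card (reach n))"
proof -
  have "P.expectation (ratio_sum n) = (\<Sum>y\<in>reach n. P.expectation (\<lambda>\<omega>. quenched_prob (cl \<omega>) 0 0 n {y} / avg_prob n y))"
    unfolding ratio_sum_def[abs_def] using expectation_quenched_point(1)
    by (intro Bochner_Integration.integral_sum integrable_divide) auto
  also have "\<dots> = (\<Sum>y\<in>reach n. 1)"
    using avg_prob_pos by (intro sum.cong refl) (auto simp: expectation_quenched_point(2) less_imp_neq[symmetric])
  finally show ?thesis by simp
qed

text \<open>All randomness sits in \<open>ratio_sum\<close>, so the estimate holds for every
  environment and every \<open>G\<close> simultaneously.\<close>

lemma quenched_prob_le:
  assumes n: "n > 0" and a: "\<And>\<xi>. \<xi> \<in> G \<Longrightarrow> ereal a \<le> I_c \<mu> \<xi>"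
  shows "quenched_prob (cl \<omega>) 0 0 n {y. (1 / real n) *\<^sub>R to_real_vec y \<in> G} \<le> exp (- (real n * a)) * ratio_sum n \<omega>"
proof -
  let ?A = "{y. (1 / real n) *\<^sub>R to_real_vec y \<in> G}"
  let ?R = "\<lambda>y. quenched_prob (cl \<omega>) 0 0 n {y} / avg_prob n y"
  have R: "?R y \<ge> 0" if "y \<in> reach n" for y
    using quenched_prob_nonneg less_imp_le[OF avg_prob_pos[OF that]] by (rule divide_nonneg_nonneg)
  have "quenched_prob (cl \<omega>) 0 0 n ?A = (\<Sum>y\<in>reach n \<inter> ?A. avg_prob n y * ?R y)"
    unfolding quenched_prob_eq_sum_reach[of _ n ?A]
    using avg_prob_pos by (intro sum.cong refl) (auto simp: less_imp_neq[symmetric])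
  also have "\<dots> \<le> (\<Sum>y\<in>reach n \<inter> ?A. exp (- (real n * a)) * ?R y)"
    using R a by (intro sum_mono mult_right_mono avg_prob_le[OF n]) auto
  also have "\<dots> \<le> (\<Sum>y\<in>reach n. exp (- (real n * a)) * ?R y)"
    by (intro sum_mono2 mult_nonneg_nonneg R) auto
  also have "\<dots> = exp (- (real n * a)) * ratio_sum n \<omega>"
    by (simp add: ratio_sum_def sum_distrib_left)
  finally show ?thesis .
qed

lemma AE_eventually_ratio_sum_le:
  "AE \<omega> in PP. eventually (\<lambda>n. ratio_sum n \<omega> \<le> real (2 * n + 1) ^ CARD('d) * (real (n + 1))\<^sup>2) sequentially"
proof -
  \<comment> \<open>The first factor bounds the mean of \<open>ratio_sum\<close>; the square makes
    the Markov bounds summable.\<close>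
  define b where "b = (\<lambda>n. real (2 * n + 1) ^ CARD('d) * (real (n + 1))\<^sup>2)"
  have b: "b n > 0" for n by (simp add: b_def)
  define A where "A = (\<lambda>n. {\<omega>\<in>space PP. ratio_sum n \<omega> \<ge> b n})"
  have A: "A n \<in> sets PP" for n
    unfolding A_def using borel_measurable_integrable[OF integrable_ratio_sum[of n]] by measurable
  have prob_A: "P.prob (A n) \<le> inverse (real (Suc n) ^ 2)" for n
  proof -
    have "P.prob (A n) \<le> P.expectation (ratio_sum n) / b n"
      unfolding A_def by (rule integral_Markov_inequality_measure[OF integrable_ratio_sum, where A = "{}"])
        (use ratio_sum_nonneg b in auto)
    also have "\<dots> \<le> real (2 * n + 1) ^ CARD('d) / b n"
      unfolding expectation_ratio_sum using card_reach_le[of n] b[of n]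
      by (intro divide_right_mono) (simp_all only: of_nat_le_iff of_nat_power[symmetric] less_imp_le)
    also have "\<dots> = inverse (real (Suc n) ^ 2)"
      by (simp add: b_def inverse_eq_divide)
    finally show ?thesis .
  qed
  have "summable (\<lambda>n. inverse (real (Suc n) ^ 2))"
    by (subst summable_Suc_iff) (rule inverse_power_summable, simp)
  then have "summable (\<lambda>n. P.prob (A n))"
    by (rule summable_comparison_test'[where N = 0]) (use prob_A in auto)
  then have "AE \<omega> in PP. eventually (\<lambda>n. \<omega> \<in> space PP - A n) sequentially"
    by (intro borel_cantelli_AE1 A) (auto simp: P.emeasure_eq_measure)
  then show ?thesis
    by eventually_elim (auto simp: A_def b_def elim!: eventually_mono)
qed

text \<open>The polynomial factor vanishes on the exponential scale. The estimate goes site by site,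
  so it is governed by \<open>I_c\<close> on \<open>G\<close> itself.\<close>

lemma limsup_ldp_le:
  assumes ev: "eventually (\<lambda>n. ratio_sum n \<omega> \<le> real (2 * n + 1) ^ CARD('d) * (real (n + 1))\<^sup>2) sequentially"
    and a: "\<And>\<xi>. \<xi> \<in> G \<Longrightarrow> ereal a \<le> I_c \<mu> \<xi>"
  shows "limsup (ldp_seq (cl \<omega>) G) \<le> ereal (- a)"
proof -
  define b where "b = (\<lambda>n. real (2 * n + 1) ^ CARD('d) * (real (n + 1))\<^sup>2)"
  have b: "b n > 0" for n by (simp add: b_def)
  have "eventually (\<lambda>n. ldp_seq (cl \<omega>) G n \<le> ereal (- a + ln (b n) / real n)) sequentially"
    using ev[folded b_def] eventually_gt_at_top[of 0]
  proof eventually_elim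
    case (elim n)
    have "quenched_prob (cl \<omega>) 0 0 n {y. (1 / real n) *\<^sub>R to_real_vec y \<in> G} \<le> exp (- (real n * a)) * ratio_sum n \<omega>"
      by (rule quenched_prob_le[OF elim(2) a])
    also have "\<dots> \<le> exp (- (real n * a)) * b n"
      using elim(1) by (intro mult_left_mono) (auto simp: b_def)
    finally have "eln (quenched_prob (cl \<omega>) 0 0 n {y. (1 / real n) *\<^sub>R to_real_vec y \<in> G}) \<le> eln (exp (- (real n * a)) * b n)"
      by (intro eln_mono quenched_prob_nonneg)
    also have "\<dots> = ereal (- (real n * a) + ln (b n))"
      using b[of n] by (simp add: eln_def ln_mult)
    finally have "ldp_seq (cl \<omega>) G n \<le> ereal (1 / real n) * ereal (- (real n * a) + ln (b n))"
      unfolding ldp_seq_def by (intro ereal_mult_left_mono) auto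
    also have "\<dots> = ereal (- a + ln (b n) / real n)"
      using elim(2) by (simp add: field_simps)
    finally show ?case .
  qed
  then have "limsup (ldp_seq (cl \<omega>) G) \<le> limsup (\<lambda>n. ereal (- a + ln (b n) / real n))"
    by (rule Limsup_mono)
  also have "\<dots> = ereal (- a)"
  proof (rule lim_imp_Limsup)
    have "ln (b n) = real CARD('d) * ln (real (2 * n + 1)) + 2 * ln (real (n + 1))" for n
      unfolding b_def by (subst ln_mult) (auto simp: ln_realpow)
    moreover have "(\<lambda>n. - a + (real CARD('d) * ln (real (2 * n + 1)) + 2 * ln (real (n + 1))) / real n) \<longlonglongrightarrow> - a"
    proof -
      have "(\<lambda>n. ln (real (2 * n + 1)) / real n) \<longlonglongrightarrow> 0" "(\<lambda>n. ln (real (n + 1)) / real n) \<longlonglongrightarrow> 0"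
        by real_asymp+
      then have "(\<lambda>n. - a + (real CARD('d) * (ln (real (2 * n + 1)) / real n) + 2 * (ln (real (n + 1)) / real n)))
         \<longlonglongrightarrow> - a + (real CARD('d) * 0 + 2 * 0)"
        by (intro tendsto_intros)
      then show ?thesis by (simp add: add_divide_distrib)
    qed
    ultimately show "(\<lambda>n. ereal (- a + ln (b n) / real n)) \<longlonglongrightarrow> ereal (- a)" by simp
  qed simp
  finally show ?thesis .
qed

section \<open>The gradient of the cumulant generating function\<close>

lemma xi_o_eq: "xi_o \<mu> = xi 0"
proof -
  have "tilt 0 z = 1" for z by (simp add: tilt_def Lambda_c_def sum_q)
  then show ?thesis by (simp add: xi_o_def xi_def)
qed

text \<open>Equals \<open>exp (\<Lambda> \<theta> - \<theta> \<bullet> \<xi>)\<close>; minimising it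
  over \<open>\<theta>\<close> solves the Legendre problem defining \<open>I_c\<close>.\<close>

definition cmgf :: "real^'d \<Rightarrow> real^'d \<Rightarrow> real" where
  "cmgf \<xi> \<theta> = (\<Sum>z\<in>steps. q z * exp (\<theta> \<bullet> (to_real_vec z - \<xi>)))"

lemma continuous_cmgf: "continuous_on S (cmgf \<xi>)"
  unfolding cmgf_def[abs_def] by (intro continuous_intros)

lemma cmgf_shift: "cmgf \<xi> \<theta> = exp (\<theta> \<bullet> (\<zeta> - \<xi>)) * cmgf \<zeta> \<theta>"
  unfolding cmgf_def sum_distrib_left
  by (intro sum.cong refl) (simp add: inner_diff_right algebra_simps flip: exp_add)

lemma xi_0_eq: "xi 0 = (\<Sum>z\<in>steps. q z *\<^sub>R to_real_vec z)"
  by (simp add: xi_o_eq[symmetric] xi_o_def)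

lemma cmgf_gt_1:
  assumes "\<theta> \<noteq> 0" shows "cmgf (xi 0) \<theta> > 1"
proof -
  let ?x = "\<lambda>z. \<theta> \<bullet> (to_real_vec z - xi 0)"
  obtain i where i: "\<theta> $ i \<noteq> 0" using assms unfolding vec_eq_iff by auto
  \<comment> \<open>The two values differ by twice the nonzero \<open>\<theta> $ i\<close>, so they
    cannot both vanish; this makes Jensen's inequality strict.\<close>
  have "?x (axis i 1) \<noteq> 0 \<or> ?x (axis i (-1)) \<noteq> 0"
    using i by (auto simp: inner_diff_right inner_axis)
  then obtain z0 where z0: "z0 \<in> steps" "?x z0 \<noteq> 0" using axis_in_steps by blast
  have "1 = (\<Sum>z\<in>steps. q z) + \<theta> \<bullet> ((\<Sum>z\<in>steps. q z *\<^sub>R to_real_vec z) - (\<Sum>z\<in>steps. q z) *\<^sub>R xi 0)"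
    by (simp add: sum_q xi_0_eq)
  also have "\<dots> = (\<Sum>z\<in>steps. q z * (1 + ?x z))"
    by (simp add: inner_diff_right inner_sum_right distrib_left right_diff_distrib sum.distrib sum_subtractf sum_distrib_right)
  also have "\<dots> < (\<Sum>z\<in>steps. q z * exp (?x z))"
  proof (rule sum_strict_mono_ex1)
    show "\<forall>z\<in>steps. q z * (1 + ?x z) \<le> q z * exp (?x z)"
      using q_pos by (auto intro!: mult_left_mono exp_ge_add_one_self intro: less_imp_le)
    have "1 + ?x z0 < exp (?x z0)"
      using z0(2) by (rule one_plus_less_exp)
    then show "\<exists>z\<in>steps. q z * (1 + ?x z) < q z * exp (?x z)"
      using z0(1) q_pos[OF z0(1)] by (intro bexI[of _ z0]) auto
  qed simp
  finally show ?thesis by (simp add: cmgf_def)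
qed

lemma xi_eq_if_critical:
  assumes "\<And>v. (\<Sum>z\<in>steps. q z * exp (\<theta> \<bullet> (to_real_vec z - \<xi>)) * (v \<bullet> (to_real_vec z - \<xi>))) = 0"
  shows "xi \<theta> = \<xi>"
proof -
  define c where "c = exp (\<Lambda> \<theta> - \<theta> \<bullet> \<xi>)"
  have e: "exp (\<theta> \<bullet> (to_real_vec z - \<xi>)) = c * tilt \<theta> z" for z
    by (simp add: c_def tilt_def inner_diff_right flip: exp_add)
  have c: "c \<noteq> 0" by (simp add: c_def)
  have "v \<bullet> (xi \<theta> - \<xi>) = 0" for v
  proof -
    have "xi \<theta> - \<xi> = xi \<theta> - (\<Sum>z\<in>steps. q z * tilt \<theta> z) *\<^sub>R \<xi>" by (simp add: sum_q_tilt)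
    also have "\<dots> = (\<Sum>z\<in>steps. (q z * tilt \<theta> z) *\<^sub>R (to_real_vec z - \<xi>))"
      by (simp add: xi_def scaleR_diff_right sum_subtractf scaleR_sum_left)
    finally have "c * (v \<bullet> (xi \<theta> - \<xi>)) = (\<Sum>z\<in>steps. q z * exp (\<theta> \<bullet> (to_real_vec z - \<xi>)) * (v \<bullet> (to_real_vec z - \<xi>)))"
      by (simp only: inner_sum_right sum_distrib_left e) (simp add: mult_ac)
    then show ?thesis using assms[of v] c by simp
  qed
  from this[of "xi \<theta> - \<xi>"] show ?thesis by simp
qed

text \<open>A variational replacement for the inverse function theorem: for \<open>\<xi>\<close>
  near the mean, \<open>cmgf \<xi>\<close> exceeds 1 on the sphere of radius \<open>\<delta>\<close>
  but equals 1 at the centre. Its minimum over the ball is therefore interior, hence critical, and a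
  critical point has tilted mean \<open>\<xi>\<close>.\<close>

lemma xi_surj_near_xi_o:
  assumes \<delta>: "\<delta> > 0"
  obtains \<eta> where "\<eta> > 0" "\<And>\<xi>. \<xi> \<in> ball (xi_o \<mu>) \<eta> \<Longrightarrow> \<exists>\<theta>. norm \<theta> < \<delta> \<and> xi \<theta> = \<xi>"
proof -
  have "sphere (0::real^'d) \<delta> \<noteq> {}" using \<delta> by (simp add: sphere_eq_empty)
  then obtain \<theta>1 where \<theta>1: "\<theta>1 \<in> sphere 0 \<delta>" "\<And>\<theta>. \<theta> \<in> sphere 0 \<delta> \<Longrightarrow> cmgf (xi 0) \<theta>1 \<le> cmgf (xi 0) \<theta>"
    using continuous_attains_inf[OF compact_sphere _ continuous_cmgf] by metis
  define m where "m = cmgf (xi 0) \<theta>1"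
  have m: "m > 1" unfolding m_def using \<theta>1(1) \<delta> by (intro cmgf_gt_1) auto
  \<comment> \<open>Moving from \<open>xi 0\<close> to \<open>\<xi>\<close> changes the exponent by
    at most \<open>\<delta> * \<eta> = ln m / 2\<close>, which leaves the square root of
    \<open>m\<close>, still above 1, on the sphere.\<close>
  define \<eta> where "\<eta> = ln m / (2 * \<delta>)"
  have \<eta>: "\<eta> > 0" using m \<delta> by (simp add: \<eta>_def)
  have "\<exists>\<theta>. norm \<theta> < \<delta> \<and> xi \<theta> = \<xi>" if \<xi>: "\<xi> \<in> ball (xi_o \<mu>) \<eta>" for \<xi>
  proof -
    have sph: "cmgf \<xi> \<theta> > 1" if "norm \<theta> = \<delta>" for \<theta>
    proof -
      have "\<bar>\<theta> \<bullet> (xi 0 - \<xi>)\<bar> \<le> norm \<theta> * norm (xi 0 - \<xi>)" by (rule Cauchy_Schwarz_ineq2)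
      also have "\<dots> \<le> \<delta> * \<eta>" using that \<xi> \<delta> by (intro mult_mono) (auto simp: xi_o_eq dist_norm)
      also have "\<dots> = ln m / 2" using \<delta> by (simp add: \<eta>_def)
      finally have "- (ln m / 2) \<le> \<theta> \<bullet> (xi 0 - \<xi>)" by linarith
      then have "exp (- (ln m / 2)) * m \<le> exp (\<theta> \<bullet> (xi 0 - \<xi>)) * cmgf (xi 0) \<theta>"
        using \<theta>1(2)[of \<theta>] that m by (intro mult_mono) (auto simp: m_def)
      also have "\<dots> = cmgf \<xi> \<theta>" by (rule cmgf_shift[symmetric])
      finally have "exp (- (ln m / 2)) * m \<le> cmgf \<xi> \<theta>" .
      moreover have "exp (- (ln m / 2)) * m = exp (ln m / 2)"
      proof -
        have "exp (- (ln m / 2)) * m = exp (- (ln m / 2)) * exp (ln m)" using m by simp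
        also have "\<dots> = exp (ln m / 2)" by (simp only: exp_add[symmetric]) simp
        finally show ?thesis .
      qed
      moreover have "exp (ln m / 2) > 1" using m by simp
      ultimately show ?thesis by linarith
    qed
    obtain \<theta> where \<theta>: "\<theta> \<in> cball 0 \<delta>" "\<And>\<theta>'. \<theta>' \<in> cball 0 \<delta> \<Longrightarrow> cmgf \<xi> \<theta> \<le> cmgf \<xi> \<theta>'"
      using continuous_attains_inf[OF compact_cball[of 0 \<delta>] _ continuous_cmgf[of _ \<xi>]] \<delta> by auto
    have "cmgf \<xi> \<theta> \<le> cmgf \<xi> 0" using \<delta> by (intro \<theta>(2)) auto
    also have "\<dots> = 1" by (simp add: cmgf_def sum_q)
    finally have "norm \<theta> \<noteq> \<delta>" using sph[of \<theta>] by auto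
    with \<theta>(1) have norm: "norm \<theta> < \<delta>" by simp
    have "xi \<theta> = \<xi>"
    proof (rule xi_eq_if_critical)
      fix v :: "real^'d"
      let ?f = "\<lambda>t::real. cmgf \<xi> (\<theta> + t *\<^sub>R v)"
      let ?D = "\<Sum>z\<in>steps. q z * exp (\<theta> \<bullet> (to_real_vec z - \<xi>)) * (v \<bullet> (to_real_vec z - \<xi>))"
      define e where "e = (\<delta> - norm \<theta>) / (1 + norm v)"
      have e: "e > 0" using norm by (simp add: e_def add_pos_nonneg)
      have "DERIV ?f 0 :> ?D"
        unfolding cmgf_def inner_add_left inner_scaleR_left
        by (auto intro!: derivative_eq_intros sum.cong simp: mult_ac)
      then show "?D = 0"
      proof (rule DERIV_local_min[OF _ e], intro allI impI)
        fix t :: real assume t: "\<bar>0 - t\<bar> < e"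
        have "norm (\<theta> + t *\<^sub>R v) \<le> norm \<theta> + \<bar>t\<bar> * norm v" by (rule norm_triangle_le) simp
        also have "\<bar>t\<bar> * norm v \<le> e * (1 + norm v)" using t by (intro mult_mono) auto
        also have "e * (1 + norm v) = \<delta> - norm \<theta>"
        proof -
          have "1 + norm v > 0" by (simp add: add_pos_nonneg)
          then show ?thesis by (simp add: e_def)
        qed
        finally have "\<theta> + t *\<^sub>R v \<in> cball 0 \<delta>" by simp
        then show "?f 0 \<le> ?f t" using \<theta>(2) by simp
      qed
    qed
    then show ?thesis using norm by blast
  qed
  then show ?thesis using \<eta> that by blast
qed

lemma continuous_Lambda: "continuous_on UNIV \<Lambda>"
proof -
  have "continuous_on UNIV (\<lambda>\<theta>. ln (mgf \<theta>))"
    unfolding mgf_def using mgf_pos[unfolded mgf_def] less_imp_neq[symmetric]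
    by (intro continuous_intros) (auto simp: less_imp_neq[symmetric])
  then show ?thesis by (simp add: Lambda_c_def[abs_def] mgf_def)
qed

lemma continuous_xi: "continuous_on UNIV xi"
  unfolding xi_def[abs_def] tilt_def
  by (intro continuous_intros continuous_Lambda)

section \<open>The quenched large deviation principle\<close>

lemma quenched_prob_mono:
  assumes "A \<subseteq> B" shows "quenched_prob (cl \<omega>) k x n A \<le> quenched_prob (cl \<omega>) k x n B"
  unfolding quenched_prob_eq using assms less_imp_le[OF path_prob_bounds(2)]
  by (intro sum_mono) auto

lemma liminf_ldp_ge:
  assumes ev: "eventually (\<lambda>n. Z \<theta> n (near \<theta> \<epsilon> n) \<omega> \<ge> exp (- \<eta> * real n)) sequentially"
    and G: "ball (xi \<theta>) \<epsilon> \<subseteq> G"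
  shows "ereal (- (\<theta> \<bullet> xi \<theta> - \<Lambda> \<theta> + norm \<theta> * \<epsilon> + \<eta>)) \<le> liminf (ldp_seq (cl \<omega>) G)"
proof (rule Liminf_bounded)
  let ?c = "\<theta> \<bullet> xi \<theta> - \<Lambda> \<theta> + norm \<theta> * \<epsilon> + \<eta>"
  show "eventually (\<lambda>n. ereal (- ?c) \<le> ldp_seq (cl \<omega>) G n) sequentially"
    using ev eventually_gt_at_top[of 0]
  proof eventually_elim
    case (elim n)
    have "exp (- (real n * ?c)) \<le> quenched_prob (cl \<omega>) 0 0 n {y. (1 / real n) *\<^sub>R to_real_vec y \<in> ball (xi \<theta>) \<epsilon>}"
      by (rule quenched_prob_ge[OF elim(2,1)])
    also have "\<dots> \<le> quenched_prob (cl \<omega>) 0 0 n {y. (1 / real n) *\<^sub>R to_real_vec y \<in> G}"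
      using G by (intro quenched_prob_mono) auto
    finally have "eln (exp (- (real n * ?c))) \<le> eln (quenched_prob (cl \<omega>) 0 0 n {y. (1 / real n) *\<^sub>R to_real_vec y \<in> G})"
      by (intro eln_mono) auto
    then have "ereal (1 / real n) * eln (exp (- (real n * ?c))) \<le> ldp_seq (cl \<omega>) G n"
      unfolding ldp_seq_def by (intro ereal_mult_left_mono) auto
    moreover have "ereal (1 / real n) * eln (exp (- (real n * ?c))) = ereal (- ?c)"
      using elim(2) by (simp add: eln_def)
    ultimately show ?case by simp
  qed
qed

text \<open>Lower bounds are secured for tilts in a countable dense set and for countably many radii
  and rates. Any other tilt is reached by continuity of \<open>xi\<close> and
  \<open>\<Lambda>\<close>, inside a single almost sure event.\<close>

lemma quenched_ldp:
  assumes d3: "CARD('d) \<ge> 3"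
  shows "\<exists>\<eta>>0. AE \<omega> in PP. \<forall>G \<in> sets (borel :: (real^'d) measure). G \<subseteq> ball (xi_o \<mu>) \<eta> \<longrightarrow>
    - (INF \<xi>\<in>interior G. I_c \<mu> \<xi>) \<le> liminf (ldp_seq \<omega> G)
    \<and> liminf (ldp_seq \<omega> G) \<le> limsup (ldp_seq \<omega> G)
    \<and> limsup (ldp_seq \<omega> G) \<le> - (INF \<xi>\<in>closure G. I_c \<mu> \<xi>)"
proof (rule tilted_pair_superharmonic[OF d3])
  fix \<delta> :: real and h :: "int^'d \<Rightarrow> real"
  assume \<delta>: "\<delta> > 0" and h: "\<And>x. h x \<ge> 1"
    and sup: "\<And>\<theta> x. norm \<theta> \<le> \<delta> \<Longrightarrow>
      (\<Sum>z\<in>steps. \<Sum>w\<in>steps. pair_kernel x z w * (tilt \<theta> z * tilt \<theta> w) * h (x + z - w)) \<le> h x"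
  obtain \<eta> where \<eta>: "\<eta> > 0" and surj: "\<And>\<xi>. \<xi> \<in> ball (xi_o \<mu>) \<eta> \<Longrightarrow> \<exists>\<theta>. norm \<theta> < \<delta> \<and> xi \<theta> = \<xi>"
    using xi_surj_near_xi_o[OF \<delta>] by blast
  obtain D :: "(real^'d) set" where D: "countable D" "\<And>X. open X \<Longrightarrow> X \<noteq> {} \<Longrightarrow> \<exists>d\<in>D. d \<in> X"
    using countable_dense_setE by blast
  have Z_AE: "AE \<omega> in PP. \<forall>\<theta>\<in>D. norm \<theta> < \<delta> \<longrightarrow> (\<forall>k l. eventually (\<lambda>n.
      Z \<theta> n (near \<theta> (inverse (real (Suc k))) n) \<omega> \<ge> exp (- inverse (real (Suc l)) * real n)) sequentially)"
  proof (subst AE_ball_countable[OF D(1)], intro ballI)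
    fix \<theta> assume "\<theta> \<in> D"
    show "AE \<omega> in PP. norm \<theta> < \<delta> \<longrightarrow> (\<forall>k l. eventually (\<lambda>n.
      Z \<theta> n (near \<theta> (inverse (real (Suc k))) n) \<omega> \<ge> exp (- inverse (real (Suc l)) * real n)) sequentially)"
    proof (cases "norm \<theta> < \<delta>")
      case True
      have "AE \<omega> in PP. \<forall>k l. eventually (\<lambda>n.
        Z \<theta> n (near \<theta> (inverse (real (Suc k))) n) \<omega> \<ge> exp (- inverse (real (Suc l)) * real n)) sequentially"
        unfolding AE_all_countable
        by (intro allI AE_eventually_Z_ge[where h = h] h sup) (use True in auto)
      then show ?thesis by (simp add: True)
    qed simp
  qed
  show ?thesis
  proof (intro exI[of _ \<eta>] conjI \<eta>)
    show "AE \<omega> in PP. \<forall>G \<in> sets (borel :: (real^'d) measure). G \<subseteq> ball (xi_o \<mu>) \<eta> \<longrightarrow>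
      - (INF \<xi>\<in>interior G. I_c \<mu> \<xi>) \<le> liminf (ldp_seq \<omega> G)
      \<and> liminf (ldp_seq \<omega> G) \<le> limsup (ldp_seq \<omega> G)
      \<and> limsup (ldp_seq \<omega> G) \<le> - (INF \<xi>\<in>closure G. I_c \<mu> \<xi>)"
      using AE_cl AE_eventually_ratio_sum_le Z_AE
    proof eventually_elim
      case (elim \<omega>)
      note clw = elim(1) and upper = elim(2) and lower = elim(3)
      show ?case
      proof (intro ballI impI conjI)
        fix G :: "(real^'d) set"
        assume G: "G \<subseteq> ball (xi_o \<mu>) \<eta>"
        show "liminf (ldp_seq \<omega> G) \<le> limsup (ldp_seq \<omega> G)"
          by (rule Liminf_le_Limsup) simp
        show "limsup (ldp_seq \<omega> G) \<le> - (INF \<xi>\<in>closure G. I_c \<mu> \<xi>)"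
        \<comment> \<open>Testing against real \<open>a\<close> also covers an infinite
          infimum.\<close>
        proof (rule ereal_le_real)
          fix a :: real
          assume "- (INF \<xi>\<in>closure G. I_c \<mu> \<xi>) \<le> ereal a"
          then have "ereal (- a) \<le> (INF \<xi>\<in>closure G. I_c \<mu> \<xi>)"
            by (simp add: ereal_uminus_le_reorder)
          then have "ereal (- a) \<le> I_c \<mu> \<xi>" if "\<xi> \<in> G" for \<xi>
            by (rule order_trans[OF _ INF_lower]) (use that closure_subset in blast)
          from limsup_ldp_le[OF upper this, of G] show "limsup (ldp_seq \<omega> G) \<le> ereal a"
            by (simp add: clw)
        qed
        have "- liminf (ldp_seq \<omega> G) \<le> (INF \<xi>\<in>interior G. I_c \<mu> \<xi>)"
        proof (rule INF_greatest)
          fix \<xi>0 assume \<xi>0: "\<xi>0 \<in> interior G"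
          then have "\<xi>0 \<in> ball (xi_o \<mu>) \<eta>" using G interior_subset by blast
          then obtain \<theta>0 where \<theta>0: "norm \<theta>0 < \<delta>" "xi \<theta>0 = \<xi>0" using surj by blast
          define J where "J = (\<lambda>\<theta>. \<theta> \<bullet> xi \<theta> - \<Lambda> \<theta>)"
          \<comment> \<open>Only the trivial half of duality enters: the value at
            \<open>\<theta>0\<close> is one of those under the supremum.\<close>
          have "ereal (J \<theta>0) \<le> I_c \<mu> \<xi>0"
            unfolding I_c_def J_def \<theta>0(2) by (rule SUP_upper) simp
          moreover have "ereal (- J \<theta>0) \<le> liminf (ldp_seq \<omega> G)"
          proof (rule ereal_le_epsilon2)
            fix e :: real assume e: "e > 0"
            obtain \<rho> where \<rho>: "\<rho> > 0" "ball \<xi>0 \<rho> \<subseteq> G"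
              using \<xi>0 by (auto simp: mem_interior)
            \<comment> \<open>\<open>\<rho> / 2\<close> keeps the small ball inside
              \<open>G\<close>, \<open>e / (3 * \<delta>)\<close> makes its cost at most
              \<open>e / 3\<close>. The rate and the variation of \<open>J\<close> take the other
              two thirds.\<close>
            define c where "c = min (\<rho> / 2) (e / (3 * \<delta>))"
            have c: "c > 0" using \<rho> e \<delta> by (simp add: c_def)
            obtain k where k: "inverse (real (Suc k)) < c" using reals_Archimedean[OF c] by blast
            obtain l where l: "inverse (real (Suc l)) < e / 3" using reals_Archimedean[of "e / 3"] e by auto
            define X where "X = {\<theta>. norm \<theta> < \<delta>} \<inter> {\<theta>. dist (xi \<theta>) \<xi>0 < \<rho> / 2} \<inter> {\<theta>. J \<theta> < J \<theta>0 + e / 3}"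
            have "continuous_on UNIV J"
              unfolding J_def by (intro continuous_intros continuous_xi continuous_Lambda)
            then have "open X"
              unfolding X_def using continuous_xi
              by (intro open_Int open_Collect_less continuous_intros) auto
            moreover have "\<theta>0 \<in> X" using \<theta>0 e \<rho> by (simp add: X_def)
            ultimately obtain \<theta> where \<theta>: "\<theta> \<in> D" "\<theta> \<in> X" using D(2)[of X] by blast
            have sub: "ball (xi \<theta>) (inverse (real (Suc k))) \<subseteq> G"
            proof -
              have "ball (xi \<theta>) (inverse (real (Suc k))) \<subseteq> ball \<xi>0 \<rho>"
              proof
                fix y assume "y \<in> ball (xi \<theta>) (inverse (real (Suc k)))"
                then have "dist (xi \<theta>) y < \<rho> / 2" using k by (simp add: c_def)
                moreover have "dist \<xi>0 (xi \<theta>) < \<rho> / 2" using \<theta>(2) by (simp add: X_def dist_commute)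
                ultimately have "dist \<xi>0 y < \<rho>" using dist_triangle[of \<xi>0 y "xi \<theta>"] by linarith
                then show "y \<in> ball \<xi>0 \<rho>" by simp
              qed
              then show ?thesis using \<rho>(2) by blast
            qed
            have "norm \<theta> < \<delta>" using \<theta>(2) by (simp add: X_def)
            with lower \<theta>(1) have ev: "eventually (\<lambda>n.
              Z \<theta> n (near \<theta> (inverse (real (Suc k))) n) \<omega> \<ge> exp (- inverse (real (Suc l)) * real n)) sequentially"
              by blast
            have "norm \<theta> * inverse (real (Suc k)) \<le> \<delta> * (e / (3 * \<delta>))"
              using \<open>norm \<theta> < \<delta>\<close> k \<delta> by (intro mult_mono) (auto simp: c_def)
            also have "\<dots> = e / 3" using \<delta> by simp
            finally have ne: "norm \<theta> * inverse (real (Suc k)) \<le> e / 3" .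
            have "ereal (- J \<theta>0) \<le> ereal (- (\<theta> \<bullet> xi \<theta> - \<Lambda> \<theta> + norm \<theta> * inverse (real (Suc k)) + inverse (real (Suc l)))) + ereal e"
              using ne l \<theta>(2) by (simp add: X_def J_def)
            also have "\<dots> \<le> liminf (ldp_seq (cl \<omega>) G) + ereal e"
              by (intro add_right_mono liminf_ldp_ge[OF ev sub])
            finally show "ereal (- J \<theta>0) \<le> liminf (ldp_seq \<omega> G) + ereal e" by (simp add: clw)
          qed
          then have "- liminf (ldp_seq \<omega> G) \<le> ereal (J \<theta>0)"
            by (simp add: ereal_uminus_le_reorder)
          ultimately show "- liminf (ldp_seq \<omega> G) \<le> I_c \<mu> \<xi>0" by (rule order_trans[rotated])
        qed
        then show "- (INF \<xi>\<in>interior G. I_c \<mu> \<xi>) \<le> liminf (ldp_seq \<omega> G)"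
          by (simp add: ereal_uminus_le_reorder)
      qed
    qed
  qed
qed

end

theorem theorem1p16:
  fixes \<mu> :: "(int^'d::finite \<Rightarrow> real) measure" and c1 :: real
  assumes d3: "CARD('d) \<ge> 3"
    and prob: "prob_space \<mu>"
    and meas: "\<forall>z\<in>(steps :: (int^'d) set). (\<lambda>v. v z) \<in> borel_measurable \<mu>"
    and pvec: "AE v in \<mu>. (\<Sum>z\<in>steps. v z) = 1"
    and c1_pos: "c1 > 0"
    and ellip: "\<forall>z\<in>steps. AE v in \<mu>. v z \<ge> c1"
  shows "\<exists>\<eta>>0. AE \<omega> in Pi\<^sub>M UNIV (\<lambda>_. \<mu>).
           \<forall>G \<in> sets (borel :: (real^'d) measure). G \<subseteq> ball (xi_o \<mu>) \<eta> \<longrightarrow>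
             - (INF \<xi>\<in>interior G. I_c \<mu> \<xi>) \<le> liminf (ldp_seq \<omega> G)
             \<and> liminf (ldp_seq \<omega> G) \<le> limsup (ldp_seq \<omega> G)
             \<and> limsup (ldp_seq \<omega> G) \<le> - (INF \<xi>\<in>closure G. I_c \<mu> \<xi>)"
proof -
  have "AE v in \<mu>. \<forall>z\<in>steps. v z \<ge> c1"
    using ellip by (simp add: AE_ball_countable countable_finite)
  with pvec have good: "AE v in \<mu>. good_row c1 v"
    by eventually_elim (simp add: good_row_def)
  interpret random_environment \<mu> c1
    by (rule random_environment.intro) (use prob meas c1_pos good in blast)+
  show ?thesis by (rule quenched_ldp[OF d3])
qed

end
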